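(* Let $\tilde M$ be a Kenmotsu manifold with structure $(\phi,\xi,\eta,g)$, and let $M=N_T\times_f N_\perp$ be a warped product semi-slant submanifold of $\tilde M$ such that $\xi\in TN_T$, where $N_T$ is an invariant submanifold and $N_\perp$ is an anti-invariant submanifold of $\tilde M$. Then for all $X\in TN_T$ and $Z\in TN_\perp$, the normal vector field $(\tilde\nabla_X N)Z$ lies in the invariant normal subbundle $\mu$, i.e. in the orthogonal complement of $N(TN_\perp)$ in $T^\perp M$.
   Context: An almost contact metric structure on a $(2n+1)$-dimensional smooth manifold $\tilde M$ is $(\phi,\xi,\eta,g)$ with $\phi$ a $(1,1)$-tensor field, $\xi$ a vector field, $\eta$ a 1-form and $g$ a Riemannian metric such that $\phi^2=-I+\eta\otimes\xi$, $\eta(\xi)=1$, $\eta\circ\phi=0$, $\phi\xi=0$, $g(X,Y)=g(\phi X,\phi Y)+\eta(X)\eta(Y)$, $g(X,\phi Y)=-g(\phi X,Y)$, $g(X,\xi)=\eta(X)$. It is Kenmotsu if $(\tilde\nabla_X\phi)Y=g(\phi X,Y)\xi-\eta(Y)\phi X$ for all $X,Y\in T\tilde M$, where $\tilde\nabla$ is the Levi-Civita connection of $g$. For a submanifold $M$ of $\tilde M$ (with induced metric, also denoted $g$), $\nabla$ is the induced Levi-Civita connection, $T^\perp M$ the normal bundle and $\nabla^\perp$ the normal connection. For $X\in TM$ write $\phi X=TX+NX$ with $TX\in TM$ and $NX\in T^\perp M$. The covariant derivative of $N$ is $(\tilde\nabla_X N)Y=\nabla^\perp_X(NY)-N(\nabla_XY)$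 for $X,Y\in TM$. Throughout, $\xi$ is tangent to $M$. A submanifold $P$ of $\tilde M$ is invariant if $\phi(TP)\subseteq TP$ and anti-invariant if $\phi(TP)\subseteq T^\perp P$. The warped product $N_1\times_f N_2$ of Riemannian manifolds $(N_1,g_1)$, $(N_2,g_2)$, with $f$ a positive differentiable function on $N_1$, is $N_1\times N_2$ with metric $g_1+f^2g_2$. A warped product submanifold of $\tilde M$ is a submanifold whose induced metric is such a warped product metric; $TN_1$ and $TN_2$ are regarded as subbundles of $TM$. A semi-slant submanifold is one with an orthogonal decomposition $TM=D_1\oplus D_2\oplus\{\xi\}$ where $\phi(D_1)=D_1$ and $D_2$ is slant with slant angle $\theta\neq0$ (the angle between $\phi X$ and $D_2$ is the constant $\theta$ for nonzero $X\in D_2$); then $T^\perp M=ND_2\oplus\mu$, where $\mu$, the orthogonal complement of $ND_2$ in $T^\perp M$, is called the invariant normal subbundle. Here $TN_T=D_1\oplus\{\xi\}$ and $TN_\perp=D_2$, with $\theta=\pi/2$. *)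

theory Defs
  imports "HOL-Analysis.Analysis"
begin

section \<open>Smooth functions between open subsets of Euclidean spaces\<close>

primrec times_differentiable_on ::
  "nat \<Rightarrow> 'a::euclidean_space set \<Rightarrow> ('a \<Rightarrow> 'b::real_normed_vector) \<Rightarrow> bool" where
  "times_differentiable_on 0 S f \<longleftrightarrow> continuous_on S f"
| "times_differentiable_on (Suc k) S f \<longleftrightarrow>
     (\<forall>x\<in>S. f differentiable (at x)) \<and>
     (\<forall>v. times_differentiable_on k S (\<lambda>x. frechet_derivative f (at x) v))"

definition smooth_on :: "'a::euclidean_space set \<Rightarrow> ('a \<Rightarrow> 'b::real_normed_vector) \<Rightarrow> bool" where
  "smooth_on S f \<longleftrightarrow> (\<forall>k. times_differentiable_on k S f)"


section \<open>Smooth manifolds\<close>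

text \<open>
  A manifold is carried by a whole (Hausdorff, second countable) type of points \<open>'p\<close> and modelled
  on a Euclidean space \<open>'e\<close>. A chart is a pair of its domain and its coordinate map; the values of
  the coordinate map outside the domain are irrelevant.

  Besides the atlas, the structure selects one chart around every point. The tangent space
  at \<open>p\<close> is the full type \<open>'e\<close>: a vector \<open>v :: 'e\<close> at \<open>p\<close> is the tangent vector with coordinates
  \<open>v\<close> in the selected chart around \<open>p\<close>, and \<open>chart_vec\<close> computes its coordinates in any
  other chart. Hence vector fields are functions \<open>'p \<Rightarrow> 'e\<close>. Fields defined only on an
  open set \<open>U\<close> are total functions whose values outside \<open>U\<close> are irrelevant.
\<close>

type_synonym ('p, 'e) chart = "'p set \<times> ('p \<Rightarrow> 'e)"

record ('p, 'e) manifold =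
  atlas :: "('p, 'e) chart set"
  chart_at :: "'p \<Rightarrow> ('p, 'e) chart"

definition chart_inv :: "('p, 'e) chart \<Rightarrow> 'e \<Rightarrow> 'p" where
  "chart_inv c = inv_into (fst c) (snd c)"

definition smooth_manifold ::
  "('p::{t2_space, second_countable_topology}, 'e::euclidean_space) manifold \<Rightarrow> bool" where
  "smooth_manifold M \<longleftrightarrow>
     (\<forall>c\<in>atlas M. open (fst c) \<and> open (snd c ` fst c) \<and>
        homeomorphism (fst c) (snd c ` fst c) (snd c) (chart_inv c)) \<and>
     (\<forall>c\<in>atlas M. \<forall>d\<in>atlas M. smooth_on (snd c ` (fst c \<inter> fst d)) (snd d \<circ> chart_inv c)) \<and>
     (\<forall>p. chart_at M p \<in> atlas M \<and> p \<in> fst (chart_at M p))"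

definition prod_chart :: "('p, 'd) chart \<Rightarrow> ('q, 'e) chart \<Rightarrow> ('p \<times> 'q, 'd \<times> 'e) chart" where
  "prod_chart c d = (fst c \<times> fst d, map_prod (snd c) (snd d))"

definition prod_manifold ::
  "('p, 'd) manifold \<Rightarrow> ('q, 'e) manifold \<Rightarrow> ('p \<times> 'q, 'd \<times> 'e) manifold" where
  "prod_manifold M N =
     \<lparr> atlas = {prod_chart c d | c d. c \<in> atlas M \<and> d \<in> atlas N},
       chart_at = (\<lambda>x. prod_chart (chart_at M (fst x)) (chart_at N (snd x))) \<rparr>"

definition smooth_fun ::
  "('p::topological_space, 'e::euclidean_space) manifold \<Rightarrow> 'p set \<Rightarrow> ('p \<Rightarrow> real) \<Rightarrow> bool" where
  "smooth_fun M U f \<longleftrightarrow> (\<forall>c\<in>atlas M. smooth_on (snd c ` (fst c \<inter> U)) (f \<circ> chart_inv c))"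

definition smooth_map ::
  "('p::topological_space, 'd::euclidean_space) manifold \<Rightarrow>
   ('q::topological_space, 'e::euclidean_space) manifold \<Rightarrow> ('p \<Rightarrow> 'q) \<Rightarrow> bool" where
  "smooth_map M N F \<longleftrightarrow> continuous_on UNIV F \<and>
     (\<forall>c\<in>atlas M. \<forall>d\<in>atlas N.
        smooth_on (snd c ` (fst c \<inter> F -` fst d)) (snd d \<circ> F \<circ> chart_inv c))"

definition chart_vec ::
  "('p, 'e::euclidean_space) manifold \<Rightarrow> ('p, 'e) chart \<Rightarrow> 'p \<Rightarrow> 'e \<Rightarrow> 'e" where
  "chart_vec M c p v =
     frechet_derivative (snd c \<circ> chart_inv (chart_at M p)) (at (snd (chart_at M p) p)) v"

text \<open>The derivative \<open>v f\<close> of a function \<open>f\<close> in the direction of the tangent vector \<open>v\<close> at \<open>p\<close>.\<close>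

definition dir_deriv ::
  "('p, 'e::euclidean_space) manifold \<Rightarrow> 'p \<Rightarrow> 'e \<Rightarrow> ('p \<Rightarrow> real) \<Rightarrow> real" where
  "dir_deriv M p v f =
     frechet_derivative (f \<circ> chart_inv (chart_at M p)) (at (snd (chart_at M p) p)) v"

definition tangent_map ::
  "('p, 'd::euclidean_space) manifold \<Rightarrow> ('q, 'e::euclidean_space) manifold \<Rightarrow>
   ('p \<Rightarrow> 'q) \<Rightarrow> 'p \<Rightarrow> 'd \<Rightarrow> 'e" where
  "tangent_map M N F p v =
     frechet_derivative (snd (chart_at N (F p)) \<circ> F \<circ> chart_inv (chart_at M p))
       (at (snd (chart_at M p) p)) v"

text \<open>
  \<open>smooth_along M N F U V\<close>: over the open set \<open>U\<close>, \<open>V\<close> is a smooth vector field along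
  \<open>F : M \<rightarrow> N\<close>, that is, a smooth section of the pullback of the tangent bundle of \<open>N\<close>, with
  \<open>V p\<close> tangent to \<open>N\<close> at \<open>F p\<close>. For \<open>F = id\<close> these are the vector fields on \<open>M\<close>.
\<close>

definition smooth_along ::
  "('p::topological_space, 'd::euclidean_space) manifold \<Rightarrow>
   ('q::topological_space, 'e::euclidean_space) manifold \<Rightarrow> ('p \<Rightarrow> 'q) \<Rightarrow>
   'p set \<Rightarrow> ('p \<Rightarrow> 'e) \<Rightarrow> bool" where
  "smooth_along M N F U V \<longleftrightarrow>
     (\<forall>c\<in>atlas M. \<forall>d\<in>atlas N. smooth_on (snd c ` (fst c \<inter> U \<inter> F -` fst d))
        (\<lambda>y. chart_vec N d (F (chart_inv c y)) (V (chart_inv c y))))"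

abbreviation smooth_field ::
  "('p::topological_space, 'e::euclidean_space) manifold \<Rightarrow> 'p set \<Rightarrow> ('p \<Rightarrow> 'e) \<Rightarrow> bool" where
  "smooth_field M \<equiv> smooth_along M M id"

text \<open>A smooth distribution of constant rank \<open>k\<close>, given by its fibres.\<close>

definition smooth_distribution ::
  "('p::topological_space, 'e::euclidean_space) manifold \<Rightarrow> ('p \<Rightarrow> 'e set) \<Rightarrow> bool" where
  "smooth_distribution M D \<longleftrightarrow>
     (\<exists>k::nat. \<forall>p. \<exists>U (E :: nat \<Rightarrow> 'p \<Rightarrow> 'e). open U \<and> p \<in> U \<and>
        (\<forall>i<k. smooth_field M U (E i)) \<and>
        (\<forall>q\<in>U. D q = span ((\<lambda>i. E i q) ` {..<k}) \<and> dim (D q) = k))"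


section \<open>Riemannian metrics and connections\<close>

text \<open>
  Tensor fields are given by their values at the points; they are smooth if they send smooth local
  vector fields to smooth objects.
\<close>

definition riemannian_manifold ::
  "('p::{t2_space, second_countable_topology}, 'e::euclidean_space) manifold \<Rightarrow>
   ('p \<Rightarrow> 'e \<Rightarrow> 'e \<Rightarrow> real) \<Rightarrow> bool" where
  "riemannian_manifold M g \<longleftrightarrow> smooth_manifold M \<and>
     (\<forall>p. bilinear (g p) \<and> (\<forall>u v. g p u v = g p v u) \<and> (\<forall>u. u \<noteq> 0 \<longrightarrow> g p u u > 0)) \<and>
     (\<forall>U X Y. open U \<and> smooth_field M U X \<and> smooth_field M U Y \<longrightarrow>
        smooth_fun M U (\<lambda>p. g p (X p) (Y p)))"

text \<open>
  A connection on the pullback under \<open>F : M \<rightarrow> N\<close> of the tangent bundle of \<open>N\<close>; \<open>D p v V\<close> is the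
  covariant derivative at \<open>p\<close> of the field \<open>V\<close> along \<open>F\<close> in the direction of the tangent vector
  \<open>v\<close> of \<open>M\<close> at \<open>p\<close>. It acts on fields that are smooth near \<open>p\<close> and depends only on their germs;
  this is the usual extension of a connection to locally defined fields.
  For \<open>F = id\<close> one gets the affine connections on \<open>M\<close>.
\<close>

definition connection_along ::
  "('p::topological_space, 'd::euclidean_space) manifold \<Rightarrow>
   ('q::topological_space, 'e::euclidean_space) manifold \<Rightarrow> ('p \<Rightarrow> 'q) \<Rightarrow>
   ('p \<Rightarrow> 'd \<Rightarrow> ('p \<Rightarrow> 'e) \<Rightarrow> 'e) \<Rightarrow> bool" where
  "connection_along M N F D \<longleftrightarrow>
     (\<forall>U V. open U \<and> smooth_along M N F U V \<longrightarrow>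
        (\<forall>p\<in>U. linear (\<lambda>v. D p v V)) \<and>
        (\<forall>X. smooth_field M U X \<longrightarrow> smooth_along M N F U (\<lambda>p. D p (X p) V)) \<and>
        (\<forall>p\<in>U. \<forall>v W. (\<forall>q\<in>U. W q = V q) \<longrightarrow> D p v W = D p v V) \<and>
        (\<forall>p\<in>U. \<forall>v W. smooth_along M N F U W \<longrightarrow>
           D p v (\<lambda>q. V q + W q) = D p v V + D p v W) \<and>
        (\<forall>p\<in>U. \<forall>v f. smooth_fun M U f \<longrightarrow>
           D p v (\<lambda>q. f q *\<^sub>R V q) = dir_deriv M p v f *\<^sub>R V p + f p *\<^sub>R D p v V))"

text \<open>
  The second conjunct says that the torsion vanishes: the bracket \<open>[X, Y]\<close> is the vector field
  acting on functions by \<open>[X, Y] f = X (Y f) - Y (X f)\<close>. The third one says that the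
  connection is compatible with the metric.
\<close>

definition levi_civita ::
  "('p::topological_space, 'e::euclidean_space) manifold \<Rightarrow> ('p \<Rightarrow> 'e \<Rightarrow> 'e \<Rightarrow> real) \<Rightarrow>
   ('p \<Rightarrow> 'e \<Rightarrow> ('p \<Rightarrow> 'e) \<Rightarrow> 'e) \<Rightarrow> bool" where
  "levi_civita M g nabla \<longleftrightarrow> connection_along M M id nabla \<and>
     (\<forall>U X Y f. open U \<and> smooth_field M U X \<and> smooth_field M U Y \<and> smooth_fun M U f \<longrightarrow>
        (\<forall>p\<in>U. dir_deriv M p (nabla p (X p) Y - nabla p (Y p) X) f =
           dir_deriv M p (X p) (\<lambda>q. dir_deriv M q (Y q) f)
           - dir_deriv M p (Y p) (\<lambda>q. dir_deriv M q (X q) f))) \<and>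
     (\<forall>U X Y. open U \<and> smooth_field M U X \<and> smooth_field M U Y \<longrightarrow>
        (\<forall>p\<in>U. \<forall>v. dir_deriv M p v (\<lambda>q. g q (X q) (Y q)) =
           g p (nabla p v X) (Y p) + g p (X p) (nabla p v Y)))"

text \<open>
  The connection \<open>nabla\<close> of \<open>N\<close>, extended (uniquely) to vector fields along \<open>F : M \<rightarrow> N\<close>.
\<close>

definition pullback_connection ::
  "('p::topological_space, 'd::euclidean_space) manifold \<Rightarrow>
   ('q::topological_space, 'e::euclidean_space) manifold \<Rightarrow> ('p \<Rightarrow> 'q) \<Rightarrow>
   ('q \<Rightarrow> 'e \<Rightarrow> ('q \<Rightarrow> 'e) \<Rightarrow> 'e) \<Rightarrow> ('p \<Rightarrow> 'd \<Rightarrow> ('p \<Rightarrow> 'e) \<Rightarrow> 'e) \<Rightarrow> bool" where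
  "pullback_connection M N F nabla D \<longleftrightarrow> connection_along M N F D \<and>
     (\<forall>W Y. open W \<and> smooth_field N W Y \<longrightarrow>
        (\<forall>p v. F p \<in> W \<longrightarrow> D p v (Y \<circ> F) = nabla (F p) (tangent_map M N F p v) Y))"


section \<open>Almost contact metric and Kenmotsu manifolds\<close>

definition almost_contact_metric ::
  "('p::{t2_space, second_countable_topology}, 'e::euclidean_space) manifold \<Rightarrow>
   ('p \<Rightarrow> 'e \<Rightarrow> 'e) \<Rightarrow> ('p \<Rightarrow> 'e) \<Rightarrow> ('p \<Rightarrow> 'e \<Rightarrow> real) \<Rightarrow>
   ('p \<Rightarrow> 'e \<Rightarrow> 'e \<Rightarrow> real) \<Rightarrow> bool" where
  "almost_contact_metric M \<phi> \<xi> \<eta> g \<longleftrightarrow>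
     (\<exists>n. DIM('e) = 2 * n + 1) \<and>
     riemannian_manifold M g \<and>
     (\<forall>p. linear (\<phi> p)) \<and> (\<forall>p. linear (\<eta> p)) \<and>
     (\<forall>U X. open U \<and> smooth_field M U X \<longrightarrow> smooth_field M U (\<lambda>p. \<phi> p (X p))) \<and>
     (\<forall>U X. open U \<and> smooth_field M U X \<longrightarrow> smooth_fun M U (\<lambda>p. \<eta> p (X p))) \<and>
     smooth_field M UNIV \<xi> \<and>
     (\<forall>p v. \<phi> p (\<phi> p v) = - v + \<eta> p v *\<^sub>R \<xi> p) \<and>
     (\<forall>p. \<eta> p (\<xi> p) = 1) \<and>
     (\<forall>p v. \<eta> p (\<phi> p v) = 0) \<and>
     (\<forall>p. \<phi> p (\<xi> p) = 0) \<and>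
     (\<forall>p u v. g p u v = g p (\<phi> p u) (\<phi> p v) + \<eta> p u * \<eta> p v) \<and>
     (\<forall>p u v. g p u (\<phi> p v) = - g p (\<phi> p u) v) \<and>
     (\<forall>p v. g p v (\<xi> p) = \<eta> p v)"

definition kenmotsu ::
  "('p::{t2_space, second_countable_topology}, 'e::euclidean_space) manifold \<Rightarrow>
   ('p \<Rightarrow> 'e \<Rightarrow> 'e) \<Rightarrow> ('p \<Rightarrow> 'e) \<Rightarrow> ('p \<Rightarrow> 'e \<Rightarrow> real) \<Rightarrow>
   ('p \<Rightarrow> 'e \<Rightarrow> 'e \<Rightarrow> real) \<Rightarrow> ('p \<Rightarrow> 'e \<Rightarrow> ('p \<Rightarrow> 'e) \<Rightarrow> 'e) \<Rightarrow> bool" where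
  "kenmotsu M \<phi> \<xi> \<eta> g nabla \<longleftrightarrow>
     almost_contact_metric M \<phi> \<xi> \<eta> g \<and> levi_civita M g nabla \<and>
     (\<forall>U X Y. open U \<and> smooth_field M U X \<and> smooth_field M U Y \<longrightarrow>
        (\<forall>p\<in>U. nabla p (X p) (\<lambda>q. \<phi> q (Y q)) - \<phi> p (nabla p (X p) Y) =
           g p (\<phi> p (X p)) (Y p) *\<^sub>R \<xi> p - \<eta> p (Y p) *\<^sub>R \<phi> p (X p)))"


section \<open>Submanifolds\<close>

text \<open>A submanifold of \<open>Q\<close> is given by an injective immersion \<open>\<iota> : M \<rightarrow> Q\<close>.\<close>

definition submanifold ::
  "('p::{t2_space, second_countable_topology}, 'd::euclidean_space) manifold \<Rightarrow>
   ('q::{t2_space, second_countable_topology}, 'e::euclidean_space) manifold \<Rightarrow>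
   ('p \<Rightarrow> 'q) \<Rightarrow> bool" where
  "submanifold M Q \<iota> \<longleftrightarrow> smooth_manifold M \<and> smooth_manifold Q \<and> smooth_map M Q \<iota> \<and>
     inj \<iota> \<and> (\<forall>x. inj (tangent_map M Q \<iota> x))"

definition induced_metric ::
  "('p, 'd::euclidean_space) manifold \<Rightarrow> ('q, 'e::euclidean_space) manifold \<Rightarrow> ('p \<Rightarrow> 'q) \<Rightarrow>
   ('q \<Rightarrow> 'e \<Rightarrow> 'e \<Rightarrow> real) \<Rightarrow> 'p \<Rightarrow> 'd \<Rightarrow> 'd \<Rightarrow> real" where
  "induced_metric M Q \<iota> g x u v = g (\<iota> x) (tangent_map M Q \<iota> x u) (tangent_map M Q \<iota> x v)"

definition normal_space ::
  "('p, 'd::euclidean_space) manifold \<Rightarrow> ('q, 'e::euclidean_space) manifold \<Rightarrow> ('p \<Rightarrow> 'q) \<Rightarrow>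
   ('q \<Rightarrow> 'e \<Rightarrow> 'e \<Rightarrow> real) \<Rightarrow> 'p \<Rightarrow> 'e set" where
  "normal_space M Q \<iota> g x = {w. \<forall>u. g (\<iota> x) w (tangent_map M Q \<iota> x u) = 0}"

definition normal_part ::
  "('p, 'd::euclidean_space) manifold \<Rightarrow> ('q, 'e::euclidean_space) manifold \<Rightarrow> ('p \<Rightarrow> 'q) \<Rightarrow>
   ('q \<Rightarrow> 'e \<Rightarrow> 'e \<Rightarrow> real) \<Rightarrow> 'p \<Rightarrow> 'e \<Rightarrow> 'e" where
  "normal_part M Q \<iota> g x w =
     (THE n. n \<in> normal_space M Q \<iota> g x \<and> w - n \<in> range (tangent_map M Q \<iota> x))"

text \<open>The normal part \<open>N u\<close> of \<open>\<phi> u\<close> for \<open>u\<close> tangent to \<open>M\<close> at \<open>x\<close>.\<close>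

definition normal_op ::
  "('p, 'd::euclidean_space) manifold \<Rightarrow> ('q, 'e::euclidean_space) manifold \<Rightarrow> ('p \<Rightarrow> 'q) \<Rightarrow>
   ('q \<Rightarrow> 'e \<Rightarrow> 'e \<Rightarrow> real) \<Rightarrow> ('q \<Rightarrow> 'e \<Rightarrow> 'e) \<Rightarrow> 'p \<Rightarrow> 'd \<Rightarrow> 'e" where
  "normal_op M Q \<iota> g \<phi> x u = normal_part M Q \<iota> g x (\<phi> (\<iota> x) (tangent_map M Q \<iota> x u))"

text \<open>The normal connection; here \<open>D\<close> is the connection of \<open>Q\<close> along \<open>\<iota>\<close>.\<close>

definition normal_connection ::
  "('p, 'd::euclidean_space) manifold \<Rightarrow> ('q, 'e::euclidean_space) manifold \<Rightarrow> ('p \<Rightarrow> 'q) \<Rightarrow>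
   ('q \<Rightarrow> 'e \<Rightarrow> 'e \<Rightarrow> real) \<Rightarrow> ('p \<Rightarrow> 'd \<Rightarrow> ('p \<Rightarrow> 'e) \<Rightarrow> 'e) \<Rightarrow>
   'p \<Rightarrow> 'd \<Rightarrow> ('p \<Rightarrow> 'e) \<Rightarrow> 'e" where
  "normal_connection M Q \<iota> g D x v V = normal_part M Q \<iota> g x (D x v V)"

text \<open>The value at \<open>x\<close> of the covariant derivative of \<open>N\<close> in the direction \<open>v\<close>, applied to \<open>Y\<close>.\<close>

definition deriv_normal_op ::
  "('p, 'd::euclidean_space) manifold \<Rightarrow> ('q, 'e::euclidean_space) manifold \<Rightarrow> ('p \<Rightarrow> 'q) \<Rightarrow>
   ('q \<Rightarrow> 'e \<Rightarrow> 'e \<Rightarrow> real) \<Rightarrow> ('q \<Rightarrow> 'e \<Rightarrow> 'e) \<Rightarrow>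
   ('p \<Rightarrow> 'd \<Rightarrow> ('p \<Rightarrow> 'e) \<Rightarrow> 'e) \<Rightarrow> ('p \<Rightarrow> 'd \<Rightarrow> ('p \<Rightarrow> 'd) \<Rightarrow> 'd) \<Rightarrow>
   'p \<Rightarrow> 'd \<Rightarrow> ('p \<Rightarrow> 'd) \<Rightarrow> 'e" where
  "deriv_normal_op M Q \<iota> g \<phi> D nabla x v Y =
     normal_connection M Q \<iota> g D x v (\<lambda>y. normal_op M Q \<iota> g \<phi> y (Y y))
     - normal_op M Q \<iota> g \<phi> x (nabla x v Y)"

definition invariant_submanifold ::
  "('p::{t2_space, second_countable_topology}, 'd::euclidean_space) manifold \<Rightarrow>
   ('q::{t2_space, second_countable_topology}, 'e::euclidean_space) manifold \<Rightarrow>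
   ('p \<Rightarrow> 'q) \<Rightarrow> ('q \<Rightarrow> 'e \<Rightarrow> 'e) \<Rightarrow> bool" where
  "invariant_submanifold P Q j \<phi> \<longleftrightarrow> submanifold P Q j \<and>
     (\<forall>x. \<phi> (j x) ` range (tangent_map P Q j x) \<subseteq> range (tangent_map P Q j x))"

definition anti_invariant_submanifold ::
  "('p::{t2_space, second_countable_topology}, 'd::euclidean_space) manifold \<Rightarrow>
   ('q::{t2_space, second_countable_topology}, 'e::euclidean_space) manifold \<Rightarrow>
   ('p \<Rightarrow> 'q) \<Rightarrow> ('q \<Rightarrow> 'e \<Rightarrow> 'e \<Rightarrow> real) \<Rightarrow> ('q \<Rightarrow> 'e \<Rightarrow> 'e) \<Rightarrow> bool" where
  "anti_invariant_submanifold P Q j g \<phi> \<longleftrightarrow> submanifold P Q j \<and>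
     (\<forall>x. \<phi> (j x) ` range (tangent_map P Q j x) \<subseteq> normal_space P Q j g x)"


section \<open>Semi-slant submanifolds\<close>

definition vec_angle :: "('e \<Rightarrow> 'e \<Rightarrow> real) \<Rightarrow> 'e \<Rightarrow> 'e \<Rightarrow> real" where
  "vec_angle h u v = arccos (h u v / (sqrt (h u u) * sqrt (h v v)))"

definition subspace_angle :: "('e::real_vector \<Rightarrow> 'e \<Rightarrow> real) \<Rightarrow> 'e \<Rightarrow> 'e set \<Rightarrow> real" where
  "subspace_angle h u W = (INF w\<in>W - {0}. vec_angle h u w)"

definition slant_distribution ::
  "('p::topological_space, 'd::euclidean_space) manifold \<Rightarrow>
   ('q, 'e::euclidean_space) manifold \<Rightarrow> ('p \<Rightarrow> 'q) \<Rightarrow>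
   ('q \<Rightarrow> 'e \<Rightarrow> 'e \<Rightarrow> real) \<Rightarrow> ('q \<Rightarrow> 'e \<Rightarrow> 'e) \<Rightarrow> ('p \<Rightarrow> 'd set) \<Rightarrow> real \<Rightarrow> bool" where
  "slant_distribution M Q \<iota> g \<phi> D \<theta> \<longleftrightarrow> smooth_distribution M D \<and>
     (\<forall>x. \<forall>u\<in>D x. u \<noteq> 0 \<longrightarrow>
        subspace_angle (g (\<iota> x)) (\<phi> (\<iota> x) (tangent_map M Q \<iota> x u))
          (tangent_map M Q \<iota> x ` D x) = \<theta>)"

text \<open>
  The distributions are given by vectors tangent to \<open>M\<close>, and \<open>t\<close> is the vector
  of \<open>M\<close> at \<open>x\<close> whose image under the differential of \<open>\<iota>\<close> is \<open>\<xi>\<close>.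
\<close>

definition semi_slant_submanifold ::
  "('p::{t2_space, second_countable_topology}, 'd::euclidean_space) manifold \<Rightarrow>
   ('q::{t2_space, second_countable_topology}, 'e::euclidean_space) manifold \<Rightarrow> ('p \<Rightarrow> 'q) \<Rightarrow>
   ('q \<Rightarrow> 'e \<Rightarrow> 'e) \<Rightarrow> ('q \<Rightarrow> 'e) \<Rightarrow> ('q \<Rightarrow> 'e \<Rightarrow> 'e \<Rightarrow> real) \<Rightarrow>
   ('p \<Rightarrow> 'd set) \<Rightarrow> ('p \<Rightarrow> 'd set) \<Rightarrow> real \<Rightarrow> bool" where
  "semi_slant_submanifold M Q \<iota> \<phi> \<xi> g D1 D2 \<theta> \<longleftrightarrow>
     submanifold M Q \<iota> \<and> smooth_distribution M D1 \<and>
     (\<forall>x. \<exists>t. tangent_map M Q \<iota> x t = \<xi> (\<iota> x) \<and>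
        (\<forall>v. \<exists>a\<in>D1 x. \<exists>b\<in>D2 x. \<exists>r. v = a + b + r *\<^sub>R t) \<and>
        (\<forall>a\<in>D1 x. \<forall>b\<in>D2 x. induced_metric M Q \<iota> g x a b = 0) \<and>
        (\<forall>a\<in>D1 x. induced_metric M Q \<iota> g x a t = 0) \<and>
        (\<forall>b\<in>D2 x. induced_metric M Q \<iota> g x b t = 0)) \<and>
     (\<forall>x. \<phi> (\<iota> x) ` tangent_map M Q \<iota> x ` D1 x = tangent_map M Q \<iota> x ` D1 x) \<and>
     slant_distribution M Q \<iota> g \<phi> D2 \<theta> \<and> \<theta> \<noteq> 0"

text \<open>The fibre at \<open>x\<close> of the orthogonal complement \<open>\<mu>\<close> of \<open>N D2\<close> in the normal bundle.\<close>

definition invariant_normal_subbundle ::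
  "('p, 'd::euclidean_space) manifold \<Rightarrow> ('q, 'e::euclidean_space) manifold \<Rightarrow> ('p \<Rightarrow> 'q) \<Rightarrow>
   ('q \<Rightarrow> 'e \<Rightarrow> 'e \<Rightarrow> real) \<Rightarrow> ('q \<Rightarrow> 'e \<Rightarrow> 'e) \<Rightarrow> ('p \<Rightarrow> 'd set) \<Rightarrow> 'p \<Rightarrow> 'e set" where
  "invariant_normal_subbundle M Q \<iota> g \<phi> D2 x =
     {w \<in> normal_space M Q \<iota> g x. \<forall>z\<in>D2 x. g (\<iota> x) w (normal_op M Q \<iota> g \<phi> x z) = 0}"


section \<open>Warped products\<close>

definition warped_metric ::
  "('p \<Rightarrow> 'c \<Rightarrow> 'c \<Rightarrow> real) \<Rightarrow> ('q \<Rightarrow> 'd \<Rightarrow> 'd \<Rightarrow> real) \<Rightarrow> ('p \<Rightarrow> real) \<Rightarrow>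
   'p \<times> 'q \<Rightarrow> 'c \<times> 'd \<Rightarrow> 'c \<times> 'd \<Rightarrow> real" where
  "warped_metric g1 g2 f x u v =
     g1 (fst x) (fst u) (fst v) + (f (fst x))\<^sup>2 * g2 (snd x) (snd u) (snd v)"

definition warped_product_submanifold ::
  "('p::{t2_space, second_countable_topology}, 'c::euclidean_space) manifold \<Rightarrow>
   ('p \<Rightarrow> 'c \<Rightarrow> 'c \<Rightarrow> real) \<Rightarrow>
   ('q::{t2_space, second_countable_topology}, 'd::euclidean_space) manifold \<Rightarrow>
   ('q \<Rightarrow> 'd \<Rightarrow> 'd \<Rightarrow> real) \<Rightarrow> ('p \<Rightarrow> real) \<Rightarrow>
   ('m::{t2_space, second_countable_topology}, 'e::euclidean_space) manifold \<Rightarrow>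
   ('m \<Rightarrow> 'e \<Rightarrow> 'e \<Rightarrow> real) \<Rightarrow> ('p \<times> 'q \<Rightarrow> 'm) \<Rightarrow> bool" where
  "warped_product_submanifold N1 g1 N2 g2 f Q g \<iota> \<longleftrightarrow>
     riemannian_manifold N1 g1 \<and> riemannian_manifold N2 g2 \<and>
     smooth_fun N1 UNIV f \<and> (\<forall>p. f p > 0) \<and>
     submanifold (prod_manifold N1 N2) Q \<iota> \<and>
     induced_metric (prod_manifold N1 N2) Q \<iota> g = warped_metric g1 g2 f"

text \<open>
  The tangent bundles of the factors, as subbundles of the tangent bundle of the product: the
  tangent space of the product at \<open>(p, q)\<close> is the product of those at \<open>p\<close> and \<open>q\<close>.
\<close>

definition factor1_bundle :: "'p \<times> 'q \<Rightarrow> ('c::zero \<times> 'd::zero) set" where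
  "factor1_bundle x = UNIV \<times> {0}"

definition factor2_bundle :: "'p \<times> 'q \<Rightarrow> ('c::zero \<times> 'd::zero) set" where
  "factor2_bundle x = {0} \<times> UNIV"

end

theory Submission
  imports Defs
begin

text \<open>
  Let \<open>d\<iota>\<close> be the differential of the immersion and \<open>Z, W\<close> tangent to the second factor. Since the
  second factor is anti-invariant, and the first one is invariant and orthogonal to it,
  \<open>\<phi>(d\<iota> Z)\<close> is normal to \<open>M\<close>, so \<open>N Z = \<phi>(d\<iota> Z)\<close>. Along \<open>\<iota>\<close> the Kenmotsu equation reads
  \<open>D\<^sub>X (\<phi>(d\<iota> Z)) = \<phi>(D\<^sub>X (d\<iota> Z)) + g(\<phi>(d\<iota> X), d\<iota> Z) \<xi> - \<eta>(d\<iota> Z) \<phi>(d\<iota> X)\<close>, where \<open>\<eta>(d\<iota> Z) = 0\<close> and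
  \<open>\<xi>\<close> is tangent to \<open>M\<close>. As \<open>\<phi>\<close> is isometric on the kernel of \<open>\<eta>\<close>, pairing \<open>(\<nabla>\<^sub>X N) Z\<close> with \<open>N W\<close> gives
  \<open>g(D\<^sub>X (d\<iota> Z), d\<iota> W) - g(d\<iota>(\<nabla>\<^sub>X Z), d\<iota> W)\<close>, which vanishes by the Gauss formula.
\<close>

section \<open>Calculus of smooth functions\<close>

text \<open>The connection \<open>D\<close> along the immersion is known only through its axioms and
  its values on fields \<open>Y \<circ> F\<close> restricted from the ambient manifold. The image of
  \<open>Z\<close> under the differential is in general not of that form, so the facts needed along
  the map (absence of torsion, metric compatibility, the Kenmotsu equation) are not simply
  inherited. Each is proved by expanding in a coordinate frame of the ambient manifold: frame fields
  composed with the map are of the admissible form, the coefficients are smooth functions, and the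
  Leibniz rule does the rest. Such frames must be built explicitly, because a tangent vector is
  stored in the selected chart of its base point and this selection need not vary continuously; a
  field with constant coordinates in a fixed chart is in general not a constant function. The Gauss
  formula then follows from the argument behind the uniqueness of the Levi-Civita connection. It is
  needed only against tangent vectors, so the second fundamental form never appears.\<close>

lemma has_derivative_cong_open:
  assumes "open S" "x \<in> S" "\<And>y. y \<in> S \<Longrightarrow> f y = g y"
  shows "(f has_derivative f') (at x) \<longleftrightarrow> (g has_derivative f') (at x)"
  using assms by (metis has_derivative_transform_within_open)

text \<open>True even where no derivative exists: \<open>frechet_derivative\<close> is a choice
  among the derivatives, and both functions have the same ones.\<close>

lemma frechet_derivative_cong_open:
  assumes "open S" "x \<in> S" "\<And>y. y \<in> S \<Longrightarrow> f y = g y"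
  shows "frechet_derivative f (at x) = frechet_derivative g (at x)"
  unfolding frechet_derivative_def using has_derivative_cong_open[OF assms] by simp

lemma differentiable_cong_open:
  assumes "open S" "x \<in> S" "\<And>y. y \<in> S \<Longrightarrow> f y = g y"
  shows "f differentiable (at x) \<longleftrightarrow> g differentiable (at x)"
  unfolding differentiable_def using has_derivative_cong_open[OF assms] by simp

lemma times_differentiable_on_mono:
  "times_differentiable_on k S f \<Longrightarrow> T \<subseteq> S \<Longrightarrow> times_differentiable_on k T f"
  by (induction k arbitrary: f) (auto intro: continuous_on_subset)

lemma times_differentiable_on_cong:
  assumes "open S"
  shows "(\<And>x. x \<in> S \<Longrightarrow> f x = g x) \<Longrightarrow>
    times_differentiable_on k S f \<longleftrightarrow> times_differentiable_on k S g"
proof (induction k arbitrary: f g)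
  case 0
  then show ?case by (simp cong: continuous_on_cong)
next
  case (Suc k)
  have "times_differentiable_on k S (\<lambda>x. frechet_derivative f (at x) v) \<longleftrightarrow>
      times_differentiable_on k S (\<lambda>x. frechet_derivative g (at x) v)" for v
    using frechet_derivative_cong_open[OF assms _ Suc.prems] by (intro Suc.IH) simp
  moreover have "f differentiable (at x) \<longleftrightarrow> g differentiable (at x)" if "x \<in> S" for x
    using differentiable_cong_open[OF assms that Suc.prems] by simp
  ultimately show ?case by simp
qed

lemma times_differentiable_on_SucD:
  "times_differentiable_on (Suc k) S f \<Longrightarrow> times_differentiable_on k S f"
proof (induction k arbitrary: f)
  case 0
  then show ?case
    by (auto intro!: continuous_at_imp_continuous_on differentiable_imp_continuous_within)
next
  case (Suc k)
  then show ?case by (metis times_differentiable_on.simps(2))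
qed

text \<open>Lets the derivative be given by a formula; uniqueness of derivatives identifies it on
  \<open>S\<close> with the \<open>frechet_derivative\<close> of the recursion.\<close>

lemma times_differentiable_on_SucI:
  assumes "open S" and d: "\<And>x. x \<in> S \<Longrightarrow> (f has_derivative f' x) (at x)"
    and "\<And>v. times_differentiable_on k S (\<lambda>x. f' x v)"
  shows "times_differentiable_on (Suc k) S f"
proof -
  have e: "f' x v = frechet_derivative f (at x) v" if "x \<in> S" for v x
    using frechet_derivative_at[OF d[OF that]] by simp
  have "times_differentiable_on k S (\<lambda>x. frechet_derivative f (at x) v)" for v
    using assms(3)[of v] times_differentiable_on_cong[OF \<open>open S\<close> e, where k=k] by simp
  then show ?thesis
    using d by (auto simp: differentiable_def)
qed

lemma times_differentiable_on_SucE: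
  assumes "times_differentiable_on (Suc k) S f"
  shows "x \<in> S \<Longrightarrow> (f has_derivative frechet_derivative f (at x)) (at x)"
    and "times_differentiable_on k S (\<lambda>x. frechet_derivative f (at x) v)"
    and "times_differentiable_on k S f"
  using assms times_differentiable_on_SucD[OF assms]
  by (auto simp: frechet_derivative_works[symmetric])

lemma times_differentiable_on_const: "times_differentiable_on k S (\<lambda>x. a)"
  by (induction k arbitrary: a) auto

lemma times_differentiable_on_linear:
  assumes "bounded_linear L"
  shows "times_differentiable_on k S f \<Longrightarrow> open S \<Longrightarrow> times_differentiable_on k S (\<lambda>x. L (f x))"
proof (induction k arbitrary: f)
  case 0
  then show ?case using bounded_linear.continuous_on[OF assms] by simp
next
  case (Suc k)
  note f = times_differentiable_on_SucE[OF Suc.prems(1)]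
  show ?case
    by (rule times_differentiable_on_SucI[OF \<open>open S\<close> bounded_linear.has_derivative[OF assms f(1)]])
      (assumption | intro Suc.IH f(2) \<open>open S\<close>)+
qed

lemma times_differentiable_on_add:
  "times_differentiable_on k S f \<Longrightarrow> times_differentiable_on k S g \<Longrightarrow> open S \<Longrightarrow>
    times_differentiable_on k S (\<lambda>x. f x + g x)"
proof (induction k arbitrary: f g)
  case 0
  then show ?case by (simp add: continuous_on_add)
next
  case (Suc k)
  note f = times_differentiable_on_SucE[OF Suc.prems(1)]
    and g = times_differentiable_on_SucE[OF Suc.prems(2)]
  show ?case
    by (rule times_differentiable_on_SucI[OF \<open>open S\<close> has_derivative_add[OF f(1) g(1)]])
      (assumption | intro Suc.IH f(2) g(2) \<open>open S\<close>)+
qed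

lemma times_differentiable_on_sum:
  assumes "open S"
  shows "(\<And>i. i \<in> I \<Longrightarrow> times_differentiable_on k S (f i)) \<Longrightarrow>
    times_differentiable_on k S (\<lambda>x. \<Sum>i\<in>I. f i x)"
  using assms
  by (induction I rule: infinite_finite_induct)
    (simp_all add: times_differentiable_on_const times_differentiable_on_add)

text \<open>The product rule produces \<open>f\<close> and \<open>g\<close> themselves next to their
  derivatives, so the induction also uses their smoothness one order below the given one.\<close>

lemma times_differentiable_on_bilinear:
  assumes "bounded_bilinear p"
  shows "times_differentiable_on k S f \<Longrightarrow> times_differentiable_on k S g \<Longrightarrow> open S \<Longrightarrow>
    times_differentiable_on k S (\<lambda>x. p (f x) (g x))"
proof (induction k arbitrary: f g)
  case 0
  then show ?case using bounded_bilinear.continuous_on[OF assms] by simp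
next
  case (Suc k)
  note f = times_differentiable_on_SucE[OF Suc.prems(1)]
    and g = times_differentiable_on_SucE[OF Suc.prems(2)]
  show ?case
    by (rule times_differentiable_on_SucI[OF \<open>open S\<close> bounded_bilinear.FDERIV[OF assms f(1) g(1)]])
      (assumption | intro times_differentiable_on_add Suc.IH f(2,3) g(2,3) \<open>open S\<close>)+
qed

lemma linear_euclidean_sum:
  fixes L :: "'a::euclidean_space \<Rightarrow> 'b::real_vector"
  assumes "linear L"
  shows "L v = (\<Sum>b\<in>Basis. (v \<bullet> b) *\<^sub>R L b)"
proof -
  have "L v = L (\<Sum>b\<in>Basis. (v \<bullet> b) *\<^sub>R b)"
    by (simp add: euclidean_representation)
  then show ?thesis
    by (simp add: linear_sum[OF assms] linear_cmul[OF assms])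
qed

text \<open>The chain rule evaluates the derivative of \<open>g\<close> in a direction that moves
  with \<open>x\<close>, whereas the induction hypothesis concerns fixed directions. Writing that
  direction in the basis leaves products of components of the derivative of \<open>f\<close> with
  derivatives of \<open>g\<close> along fixed \<open>b\<close>, composed with the same
  \<open>f\<close>.\<close>

lemma times_differentiable_on_compose:
  fixes f :: "'a::euclidean_space \<Rightarrow> 'b::euclidean_space"
    and g :: "'b \<Rightarrow> 'c::real_normed_vector"
  assumes "open S" "f ` S \<subseteq> T"
  shows "times_differentiable_on k S f \<Longrightarrow> times_differentiable_on k T g \<Longrightarrow>
    times_differentiable_on k S (\<lambda>x. g (f x))"
proof (induction k arbitrary: g)
  case 0
  then show ?case
    using assms(2) continuous_on_compose2 by (metis times_differentiable_on.simps(1))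
next
  case (Suc k)
  note f = times_differentiable_on_SucE[OF Suc.prems(1)]
    and g = times_differentiable_on_SucE[OF Suc.prems(2)]
  have d: "((\<lambda>x. g (f x)) has_derivative (\<lambda>v. \<Sum>b\<in>Basis.
      (frechet_derivative f (at x) v \<bullet> b) *\<^sub>R frechet_derivative g (at (f x)) b)) (at x)"
    if "x \<in> S" for x
  proof -
    have "f x \<in> T" using that assms(2) by auto
    note g' = g(1)[OF this]
    show ?thesis
      using diff_chain_at[OF f(1)[OF that] g'] unfolding o_def
      by (subst (asm) linear_euclidean_sum[OF has_derivative_linear[OF g']])
  qed
  have t: "times_differentiable_on k S (\<lambda>x. \<Sum>b\<in>Basis.
      (frechet_derivative f (at x) v \<bullet> b) *\<^sub>R frechet_derivative g (at (f x)) b)" for v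
  proof (rule times_differentiable_on_sum[OF \<open>open S\<close>])
    fix b
    show "times_differentiable_on k S (\<lambda>x.
        (frechet_derivative f (at x) v \<bullet> b) *\<^sub>R frechet_derivative g (at (f x)) b)"
      using times_differentiable_on_linear[OF bounded_linear_inner_left f(2) \<open>open S\<close>]
        Suc.IH[OF f(3) g(2)] \<open>open S\<close>
      by (rule times_differentiable_on_bilinear[OF bounded_bilinear_scaleR])
  qed
  show ?case
    by (rule times_differentiable_on_SucI[OF \<open>open S\<close>]) (erule d, rule t)
qed

lemma smooth_on_mono: "smooth_on S f \<Longrightarrow> T \<subseteq> S \<Longrightarrow> smooth_on T f"
  unfolding smooth_on_def using times_differentiable_on_mono by blast

lemma smooth_on_cong:
  assumes "open S" "\<And>x. x \<in> S \<Longrightarrow> f x = g x" "smooth_on S f"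
  shows "smooth_on S g"
  using assms(3) times_differentiable_on_cong[where f=f and g=g, OF assms(1,2)]
  unfolding smooth_on_def by simp

lemma smooth_on_const: "smooth_on S (\<lambda>x. a)"
  by (simp add: smooth_on_def times_differentiable_on_const)

lemma smooth_on_linear:
  "bounded_linear L \<Longrightarrow> smooth_on S f \<Longrightarrow> open S \<Longrightarrow> smooth_on S (\<lambda>x. L (f x))"
  by (simp add: smooth_on_def times_differentiable_on_linear)

lemma smooth_on_add:
  "smooth_on S f \<Longrightarrow> smooth_on S g \<Longrightarrow> open S \<Longrightarrow> smooth_on S (\<lambda>x. f x + g x)"
  by (simp add: smooth_on_def times_differentiable_on_add)

lemma smooth_on_sum:
  "open S \<Longrightarrow> (\<And>i. i \<in> I \<Longrightarrow> smooth_on S (f i)) \<Longrightarrow> smooth_on S (\<lambda>x. \<Sum>i\<in>I. f i x)"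
  by (simp add: smooth_on_def times_differentiable_on_sum)

lemma smooth_on_bilinear:
  "bounded_bilinear p \<Longrightarrow> smooth_on S f \<Longrightarrow> smooth_on S g \<Longrightarrow> open S \<Longrightarrow>
    smooth_on S (\<lambda>x. p (f x) (g x))"
  by (simp add: smooth_on_def times_differentiable_on_bilinear)

lemma smooth_on_compose:
  fixes f :: "'a::euclidean_space \<Rightarrow> 'b::euclidean_space"
  assumes "open S" "f ` S \<subseteq> T" "smooth_on S f" "smooth_on T g"
  shows "smooth_on S (\<lambda>x. g (f x))"
  using assms(3,4) times_differentiable_on_compose[OF assms(1,2)] unfolding smooth_on_def by auto

lemma smooth_on_derivative:
  "smooth_on S f \<Longrightarrow> smooth_on S (\<lambda>x. frechet_derivative f (at x) v)"
  by (metis smooth_on_def times_differentiable_on.simps(2))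

lemma smooth_on_differentiable: "smooth_on S f \<Longrightarrow> x \<in> S \<Longrightarrow> f differentiable (at x)"
  by (metis smooth_on_def times_differentiable_on.simps(2))

section \<open>Derivatives in charts\<close>

text \<open>Coordinate changes, directional derivatives and tangent maps are all of this shape, so a
  single chain rule serves all three.\<close>

definition chart_deriv ::
  "('p, 'd::euclidean_space) chart \<Rightarrow> ('p \<Rightarrow> 'b::real_normed_vector) \<Rightarrow> 'p \<Rightarrow> 'd \<Rightarrow> 'b" where
  "chart_deriv c H p = frechet_derivative (H \<circ> chart_inv c) (at (snd c p))"

definition chart_differentiable ::
  "('p, 'd::euclidean_space) chart \<Rightarrow> ('p \<Rightarrow> 'b::real_normed_vector) \<Rightarrow> 'p \<Rightarrow> bool" where
  "chart_differentiable c H p \<longleftrightarrow> (H \<circ> chart_inv c) differentiable (at (snd c p))"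

lemma chart_differentiableD:
  "chart_differentiable c H p \<Longrightarrow>
    ((H \<circ> chart_inv c) has_derivative chart_deriv c H p) (at (snd c p))"
  by (simp add: chart_differentiable_def chart_deriv_def frechet_derivative_works[symmetric])

lemma chart_derivI:
  assumes "((H \<circ> chart_inv c) has_derivative h) (at (snd c p))"
  shows "chart_differentiable c H p" "chart_deriv c H p = h"
  using assms frechet_derivative_at[OF assms]
  by (auto simp: chart_differentiable_def chart_deriv_def differentiable_def)

lemma linear_chart_deriv: "chart_differentiable c H p \<Longrightarrow> linear (chart_deriv c H p)"
  by (rule has_derivative_linear[OF chart_differentiableD])

lemma chart_vec_eq: "chart_vec M c p v = chart_deriv (chart_at M p) (snd c) p v"
  and dir_deriv_eq: "dir_deriv M p v f = chart_deriv (chart_at M p) f p v"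
  and tangent_map_eq: "tangent_map M N F p v =
    chart_deriv (chart_at M p) (snd (chart_at N (F p)) \<circ> F) p v"
  by (simp_all add: chart_vec_def dir_deriv_def tangent_map_def chart_deriv_def)

lemma chart_at_atlas:
  assumes "smooth_manifold M"
  shows "chart_at M p \<in> atlas M" "p \<in> fst (chart_at M p)"
  using assms unfolding smooth_manifold_def by blast+

lemma atlas_chart:
  assumes "smooth_manifold M" "c \<in> atlas M"
  shows "open (fst c)" "open (snd c ` fst c)"
    "homeomorphism (fst c) (snd c ` fst c) (snd c) (chart_inv c)"
    "continuous_on (snd c ` fst c) (chart_inv c)"
    "p \<in> fst c \<Longrightarrow> chart_inv c (snd c p) = p"
    "y \<in> snd c ` fst c \<Longrightarrow> chart_inv c y \<in> fst c"
    "y \<in> snd c ` fst c \<Longrightarrow> snd c (chart_inv c y) = y"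
proof -
  show *: "open (fst c)" "open (snd c ` fst c)"
    "homeomorphism (fst c) (snd c ` fst c) (snd c) (chart_inv c)"
    using assms unfolding smooth_manifold_def by blast+
  show "continuous_on (snd c ` fst c) (chart_inv c)"
    "p \<in> fst c \<Longrightarrow> chart_inv c (snd c p) = p"
    "y \<in> snd c ` fst c \<Longrightarrow> chart_inv c y \<in> fst c"
    "y \<in> snd c ` fst c \<Longrightarrow> snd c (chart_inv c y) = y"
    using *(3) by (auto simp: homeomorphism_def)
qed

text \<open>The image is the preimage of \<open>U\<close> under the continuous inverse chart, taken
  inside the open range of coordinates.\<close>

lemma open_chart_image:
  assumes "smooth_manifold M" "c \<in> atlas M" "open U"
  shows "open (snd c ` (fst c \<inter> U))"
proof -
  note c = atlas_chart[OF assms(1,2)]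
  have "snd c ` (fst c \<inter> U) = snd c ` fst c \<inter> chart_inv c -` U"
    using c(5,7) by force
  then show ?thesis
    using continuous_openin_preimage_gen[OF c(4) assms(3)] c(2)
    by (metis openin_open_eq)
qed

lemma chart_derivative_cong:
  assumes "smooth_manifold M" "c \<in> atlas M" "open U" "p \<in> fst c" "p \<in> U"
    and eq: "\<And>q. q \<in> U \<Longrightarrow> G q = H q"
  shows "chart_deriv c G p = chart_deriv c H p"
    and "chart_differentiable c G p \<longleftrightarrow> chart_differentiable c H p"
proof -
  have o: "open (snd c ` (fst c \<inter> U))" "snd c p \<in> snd c ` (fst c \<inter> U)"
    using open_chart_image[OF assms(1-3)] assms(4,5) by auto
  have e: "(G \<circ> chart_inv c) y = (H \<circ> chart_inv c) y" if "y \<in> snd c ` (fst c \<inter> U)" for y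
    using that atlas_chart(5)[OF assms(1,2)] eq by auto
  show "chart_deriv c G p = chart_deriv c H p"
    unfolding chart_deriv_def using frechet_derivative_cong_open[OF o e] .
  show "chart_differentiable c G p \<longleftrightarrow> chart_differentiable c H p"
    unfolding chart_differentiable_def using differentiable_cong_open[OF o e] .
qed

text \<open>Near \<open>snd c p\<close> the map \<open>H \<circ> F \<circ> chart_inv c\<close>
  factors through the coordinates of \<open>d\<close>; continuity of \<open>F\<close> makes the set
  where it does so open.\<close>

lemma chart_deriv_chain:
  assumes M: "smooth_manifold M" "c \<in> atlas M" "p \<in> fst c"
    and N: "smooth_manifold N" "d \<in> atlas N" "F p \<in> fst d"
    and F: "continuous_on UNIV F" "chart_differentiable c (snd d \<circ> F) p"
    and H: "chart_differentiable d H (F p)"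
  shows "chart_differentiable c (H \<circ> F) p"
    and "chart_deriv c (H \<circ> F) p v = chart_deriv d H (F p) (chart_deriv c (snd d \<circ> F) p v)"
proof -
  note c = atlas_chart[OF M(1,2)] and d = atlas_chart[OF N(1,2)]
  let ?S = "snd c ` (fst c \<inter> F -` fst d)"
  have S: "open ?S" "snd c p \<in> ?S"
    using open_chart_image[OF M(1,2), of "F -` fst d"] F(1) d(1) M(3) N(3)
    by (auto simp: continuous_on_open_vimage)
  have "((H \<circ> chart_inv d) has_derivative chart_deriv d H (F p))
      (at ((snd d \<circ> F \<circ> chart_inv c) (snd c p)))"
    using chart_differentiableD[OF H] c(5)[OF M(3)] by simp
  from diff_chain_at[OF chart_differentiableD[OF F(2)] this]
  have "(((H \<circ> F) \<circ> chart_inv c) has_derivative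
      chart_deriv d H (F p) \<circ> chart_deriv c (snd d \<circ> F) p) (at (snd c p))"
    by (subst (asm) has_derivative_cong_open[OF S, where g="(H \<circ> F) \<circ> chart_inv c"])
      (auto simp: c(5) d(5))
  from chart_derivI[OF this] show "chart_differentiable c (H \<circ> F) p"
    "chart_deriv c (H \<circ> F) p v = chart_deriv d H (F p) (chart_deriv c (snd d \<circ> F) p v)"
    by auto
qed

section \<open>Smooth maps in charts and coordinate frames\<close>

lemma smooth_map_id: "smooth_manifold M \<Longrightarrow> smooth_map M M id"
  by (auto simp: smooth_map_def smooth_manifold_def)

locale manifold_map =
  fixes M :: "('p::{t2_space, second_countable_topology}, 'd::euclidean_space) manifold"
    and N :: "('q::{t2_space, second_countable_topology}, 'e::euclidean_space) manifold"
    and F :: "'p \<Rightarrow> 'q"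
  assumes M: "smooth_manifold M" and N: "smooth_manifold N" and F: "smooth_map M N F"
begin

lemma continuous: "continuous_on UNIV F"
  using F by (simp add: smooth_map_def)

lemma open_vimage: "open V \<Longrightarrow> open (F -` V)"
  using continuous by (auto simp: continuous_on_open_vimage)

lemma open_vimage_chart: "d \<in> atlas N \<Longrightarrow> open (F -` fst d)"
  by (rule open_vimage) (rule atlas_chart(1)[OF N])

lemma chart_differentiable:
  assumes "c \<in> atlas M" "d \<in> atlas N" "p \<in> fst c" "F p \<in> fst d"
  shows "chart_differentiable c (snd d \<circ> F) p"
  unfolding chart_differentiable_def
  by (rule smooth_on_differentiable[where S="snd c ` (fst c \<inter> F -` fst d)"])
    (use F assms in \<open>auto simp: smooth_map_def\<close>)

lemmas chain = chart_deriv_chain[OF M _ _ N _ _ continuous chart_differentiable]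

end

lemma manifold_map_id: "smooth_manifold M \<Longrightarrow> manifold_map M M id"
  by (simp add: manifold_map_def smooth_map_id)

lemma chart_change:
  assumes "smooth_manifold M" "c \<in> atlas M" "d \<in> atlas M" "p \<in> fst c" "p \<in> fst d"
    "chart_differentiable d H p"
  shows "chart_differentiable c H p"
    "chart_deriv c H p v = chart_deriv d H p (chart_deriv c (snd d) p v)"
  using manifold_map.chain[OF manifold_map_id, OF assms(1), where p=p and c=c and d=d and H=H] assms
  by auto

lemma chart_differentiable_transition:
  assumes "smooth_manifold M" "c \<in> atlas M" "d \<in> atlas M" "p \<in> fst c" "p \<in> fst d"
  shows "chart_differentiable c (snd d) p"
  using manifold_map.chart_differentiable[OF manifold_map_id, OF assms(1), of c d p] assms by auto

lemma chart_deriv_self: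
  assumes "smooth_manifold M" "c \<in> atlas M" "p \<in> fst c"
  shows "chart_deriv c (snd c) p v = v"
proof -
  have "((snd c \<circ> chart_inv c) has_derivative (\<lambda>v. v)) (at (snd c p))"
    by (subst has_derivative_cong_open[where g="\<lambda>x. x" and S="snd c ` fst c"])
      (use atlas_chart[OF assms(1,2)] assms(3) in auto)
  from chart_derivI(2)[OF this] show ?thesis by simp
qed

text \<open>The field with constant coordinates \<open>v\<close> in the chart \<open>c\<close>; at \<open>p\<close> it is represented in the
  selected chart around \<open>p\<close>.\<close>

definition chart_frame :: "('p, 'e::euclidean_space) manifold \<Rightarrow> ('p, 'e) chart \<Rightarrow> 'e \<Rightarrow> 'p \<Rightarrow> 'e" where
  "chart_frame M c v p = chart_deriv c (snd (chart_at M p)) p v"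

text \<open>Going from \<open>c\<close> to the selected chart at \<open>p\<close> and on to
  \<open>d\<close> is the direct transition from \<open>c\<close> to \<open>d\<close>: the selected
  chart cancels.\<close>

lemma chart_vec_chart_frame:
  assumes "smooth_manifold M" "c \<in> atlas M" "d \<in> atlas M" "p \<in> fst c" "p \<in> fst d"
  shows "chart_vec M d p (chart_frame M c v p) = chart_deriv c (snd d) p v"
  unfolding chart_vec_eq chart_frame_def
  using assms chart_at_atlas[OF assms(1)]
  by (intro chart_change(2)[OF assms(1), symmetric] chart_differentiable_transition) auto

lemma chart_frame_chart_vec:
  assumes "smooth_manifold M" "c \<in> atlas M" "p \<in> fst c"
  shows "chart_frame M c (chart_vec M c p v) p = v"
proof -
  note at = chart_at_atlas[OF assms(1)]
  have "chart_deriv c (snd (chart_at M p)) p (chart_deriv (chart_at M p) (snd c) p v) =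
      chart_deriv (chart_at M p) (snd (chart_at M p)) p v"
    using assms at
    by (intro chart_change(2)[OF assms(1), symmetric] chart_differentiable_transition) auto
  then show ?thesis
    using at by (simp add: chart_vec_eq chart_frame_def chart_deriv_self[OF assms(1)])
qed

lemma linear_chart_frame:
  assumes "smooth_manifold M" "c \<in> atlas M" "p \<in> fst c"
  shows "linear (\<lambda>v. chart_frame M c v p)"
  unfolding chart_frame_def using assms chart_at_atlas[OF assms(1)]
  by (intro linear_chart_deriv chart_differentiable_transition) auto

lemma linear_chart_vec:
  assumes "smooth_manifold M" "c \<in> atlas M" "p \<in> fst c"
  shows "linear (chart_vec M c p)"
  unfolding chart_vec_eq[abs_def] using assms chart_at_atlas[OF assms(1)]
  by (intro linear_chart_deriv chart_differentiable_transition) auto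

text \<open>This reduces arbitrary fields to frame fields with function coefficients, to which both
  the Leibniz rule and the pullback axiom apply.\<close>

lemma chart_frame_expansion:
  assumes "smooth_manifold M" "c \<in> atlas M" "p \<in> fst c"
  shows "v = (\<Sum>b\<in>Basis. (chart_vec M c p v \<bullet> b) *\<^sub>R chart_frame M c b p)"
  using linear_euclidean_sum[OF linear_chart_frame[OF assms], of "chart_vec M c p v"]
  by (simp add: chart_frame_chart_vec[OF assms])

context manifold_map
begin

lemma linear_tangent_map: "linear (tangent_map M N F p)"
  unfolding tangent_map_eq[abs_def]
  by (intro linear_chart_deriv chart_differentiable chart_at_atlas M N)

text \<open>\<open>tangent_map\<close> refers to the selected charts at \<open>p\<close> and
  \<open>F p\<close>. The chain rule removes the one of the target, a chart change the one of the
  source.\<close>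

lemma chart_vec_tangent_map:
  assumes "c \<in> atlas M" "d \<in> atlas N" "p \<in> fst c" "F p \<in> fst d"
  shows "chart_vec N d (F p) (tangent_map M N F p v) =
    chart_deriv c (snd d \<circ> F) p (chart_vec M c p v)"
proof -
  let ?c = "chart_at M p" and ?d = "chart_at N (F p)"
  note at = chart_at_atlas[OF M] chart_at_atlas[OF N]
  have "chart_deriv ?d (snd d) (F p) (chart_deriv ?c (snd ?d \<circ> F) p v) =
      chart_deriv ?c (snd d \<circ> F) p v"
    using assms at by (intro chain(2)[symmetric] chart_differentiable_transition[OF N]) auto
  also have "\<dots> = chart_deriv c (snd d \<circ> F) p (chart_deriv ?c (snd c) p v)"
    using assms at by (intro chart_change(2)[OF M] chart_differentiable) auto
  finally show ?thesis
    by (simp add: chart_vec_eq tangent_map_eq)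
qed

lemma dir_deriv_comp:
  assumes "chart_differentiable (chart_at N (F p)) f (F p)"
  shows "dir_deriv M p v (f \<circ> F) = dir_deriv N (F p) (tangent_map M N F p v) f"
  unfolding dir_deriv_eq tangent_map_eq
  using assms chart_at_atlas[OF M] chart_at_atlas[OF N]
  by (intro chain(2)) auto

end
section \<open>Smooth fields along a map and connections\<close>

lemma chart_domainD:
  assumes "smooth_manifold M" "c \<in> atlas M" "y \<in> snd c ` (fst c \<inter> U)"
  shows "chart_inv c y \<in> fst c" "chart_inv c y \<in> U" "snd c (chart_inv c y) = y"
  using assms(3) atlas_chart(5)[OF assms(1,2)] by auto

lemma smooth_fun_chart_differentiable:
  assumes "smooth_fun M U f" "p \<in> U" "c \<in> atlas M" "p \<in> fst c"
  shows "chart_differentiable c f p"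
  unfolding chart_differentiable_def
  by (rule smooth_on_differentiable[where S="snd c ` (fst c \<inter> U)"])
    (use assms in \<open>auto simp: smooth_fun_def\<close>)

lemma smooth_along_mono: "smooth_along M N F U V \<Longrightarrow> W \<subseteq> U \<Longrightarrow> smooth_along M N F W V"
  unfolding smooth_along_def by (blast intro: smooth_on_mono)

lemma dir_deriv_cong:
  assumes "smooth_manifold M" "open U" "p \<in> U" "\<And>q. q \<in> U \<Longrightarrow> f q = h q"
  shows "dir_deriv M p v f = dir_deriv M p v h"
  unfolding dir_deriv_eq
  using chart_derivative_cong(1)[OF assms(1) chart_at_atlas(1)[OF assms(1)] assms(2)
      chart_at_atlas(2)[OF assms(1)] assms(3,4)] by simp

lemma linear_dir_deriv:
  assumes "smooth_manifold M" "smooth_fun M U f" "p \<in> U"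
  shows "linear (\<lambda>v. dir_deriv M p v f)"
  unfolding dir_deriv_eq[abs_def] using assms chart_at_atlas[OF assms(1)]
  by (intro linear_chart_deriv smooth_fun_chart_differentiable[OF assms(2)]) auto

lemma chart_deriv_sum:
  assumes "\<And>i. i \<in> I \<Longrightarrow> chart_differentiable c (f i) p"
  shows "chart_differentiable c (\<lambda>q. \<Sum>i\<in>I. f i q) p"
    and "chart_deriv c (\<lambda>q. \<Sum>i\<in>I. f i q) p v = (\<Sum>i\<in>I. chart_deriv c (f i) p v)"
proof -
  have "((\<lambda>q. \<Sum>i\<in>I. f i q) \<circ> chart_inv c has_derivative
      (\<lambda>v. \<Sum>i\<in>I. chart_deriv c (f i) p v)) (at (snd c p))"
    unfolding o_def using assms[THEN chart_differentiableD]
    by (intro has_derivative_sum) (simp add: o_def)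
  from chart_derivI[OF this] show "chart_differentiable c (\<lambda>q. \<Sum>i\<in>I. f i q) p"
    "chart_deriv c (\<lambda>q. \<Sum>i\<in>I. f i q) p v = (\<Sum>i\<in>I. chart_deriv c (f i) p v)" by auto
qed

lemma chart_deriv_mult:
  fixes f h :: "'p::{t2_space, second_countable_topology} \<Rightarrow> real"
  assumes "smooth_manifold M" "c \<in> atlas M" "p \<in> fst c"
    and "chart_differentiable c f p" "chart_differentiable c h p"
  shows "chart_differentiable c (\<lambda>q. f q * h q) p"
    and "chart_deriv c (\<lambda>q. f q * h q) p v = f p * chart_deriv c h p v + chart_deriv c f p v * h p"
proof -
  have "((\<lambda>q. f q * h q) \<circ> chart_inv c has_derivative
      (\<lambda>v. f p * chart_deriv c h p v + chart_deriv c f p v * h p)) (at (snd c p))"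
    using has_derivative_mult[OF assms(4,5)[THEN chart_differentiableD]]
    by (simp add: o_def atlas_chart(5)[OF assms(1-3)])
  from chart_derivI[OF this] show "chart_differentiable c (\<lambda>q. f q * h q) p"
    "chart_deriv c (\<lambda>q. f q * h q) p v = f p * chart_deriv c h p v + chart_deriv c f p v * h p"
    by auto
qed

lemma smooth_fun_coordinate:
  assumes "smooth_manifold M" "c \<in> atlas M"
  shows "smooth_fun M (fst c) (\<lambda>q. snd c q \<bullet> b)"
  unfolding smooth_fun_def
proof
  fix d assume d: "d \<in> atlas M"
  have o: "open (snd d ` (fst d \<inter> fst c))"
    using open_chart_image[OF assms(1) d] atlas_chart(1)[OF assms] by simp
  have "smooth_on (snd d ` (fst d \<inter> fst c)) (snd c \<circ> chart_inv d)"
    using assms d by (simp add: smooth_manifold_def)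
  from smooth_on_linear[OF bounded_linear_inner_left this o]
  show "smooth_on (snd d ` (fst d \<inter> fst c)) ((\<lambda>q. snd c q \<bullet> b) \<circ> chart_inv d)"
    by (simp add: o_def)
qed

text \<open>Seen from \<open>e\<close> and \<open>d\<close>, the field is the derivative of the
  transition from \<open>c\<close> to \<open>d\<close> in the fixed direction \<open>v\<close>,
  composed with the transition from \<open>e\<close> to \<open>c\<close>.\<close>

lemma smooth_field_chart_frame:
  assumes M: "smooth_manifold M" and c: "c \<in> atlas M"
  shows "smooth_field M (fst c) (chart_frame M c v)"
  unfolding smooth_along_def
proof (intro ballI)
  fix e d assume e: "e \<in> atlas M" and d: "d \<in> atlas M"
  let ?S = "snd e ` (fst e \<inter> (fst c \<inter> fst d))"
  have o: "open ?S"
    by (intro open_chart_image[OF M e] open_Int atlas_chart(1)[OF M c] atlas_chart(1)[OF M d])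
  have 1: "smooth_on ?S (snd c \<circ> chart_inv e)"
    by (rule smooth_on_mono[where S="snd e ` (fst e \<inter> fst c)"])
      (use M c e in \<open>auto simp: smooth_manifold_def\<close>)
  have 2: "smooth_on (snd c ` (fst c \<inter> fst d)) (\<lambda>z. frechet_derivative (snd d \<circ> chart_inv c) (at z) v)"
    by (rule smooth_on_derivative) (use M c d in \<open>auto simp: smooth_manifold_def\<close>)
  have "(snd c \<circ> chart_inv e) ` ?S \<subseteq> snd c ` (fst c \<inter> fst d)"
    using chart_domainD(2)[OF M e] by auto
  note s = smooth_on_compose[OF o this 1 2]
  have "smooth_on ?S (\<lambda>y. chart_vec M d (chart_inv e y) (chart_frame M c v (chart_inv e y)))"
  proof (rule smooth_on_cong[OF o _ s])
    fix y assume "y \<in> ?S"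
    from chart_domainD[OF M e this]
    show "frechet_derivative (snd d \<circ> chart_inv c) (at ((snd c \<circ> chart_inv e) y)) v =
        chart_vec M d (chart_inv e y) (chart_frame M c v (chart_inv e y))"
      by (simp add: chart_vec_chart_frame[OF M c d] chart_deriv_def)
  qed
  then show "smooth_on (snd e ` (fst e \<inter> fst c \<inter> id -` fst d))
      (\<lambda>y. chart_vec M d (id (chart_inv e y)) (chart_frame M c v (chart_inv e y)))"
    by (simp add: Int_assoc)
qed

context manifold_map
begin

lemma open_domain:
  "c \<in> atlas M \<Longrightarrow> d \<in> atlas N \<Longrightarrow> open U \<Longrightarrow> open (snd c ` (fst c \<inter> U \<inter> F -` fst d))"
  using open_chart_image[OF M, of c "U \<inter> F -` fst d"] open_vimage_chart
  by (simp add: Int_assoc open_Int)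

lemma domainD:
  assumes "c \<in> atlas M" "y \<in> snd c ` (fst c \<inter> U \<inter> F -` fst d)"
  shows "chart_inv c y \<in> fst c" "chart_inv c y \<in> U" "F (chart_inv c y) \<in> fst d"
    "snd c (chart_inv c y) = y"
  using assms(2) atlas_chart(5)[OF M assms(1)] by auto

lemma smooth_fun_component:
  assumes "open U" "smooth_along M N F U V" "d \<in> atlas N"
  shows "smooth_fun M (U \<inter> F -` fst d) (\<lambda>q. chart_vec N d (F q) (V q) \<bullet> b)"
  unfolding smooth_fun_def
proof
  fix c assume c: "c \<in> atlas M"
  have "smooth_on (snd c ` (fst c \<inter> U \<inter> F -` fst d))
      (\<lambda>y. chart_vec N d (F (chart_inv c y)) (V (chart_inv c y)))"
    using assms(2,3) c by (simp add: smooth_along_def)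
  from smooth_on_linear[OF bounded_linear_inner_left this open_domain[OF c assms(3,1)]]
  show "smooth_on (snd c ` (fst c \<inter> (U \<inter> F -` fst d)))
      ((\<lambda>q. chart_vec N d (F q) (V q) \<bullet> b) \<circ> chart_inv c)"
    by (simp add: o_def Int_assoc)
qed

lemma smooth_along_add:
  assumes "open U" "smooth_along M N F U V" "smooth_along M N F U W"
  shows "smooth_along M N F U (\<lambda>q. V q + W q)"
  unfolding smooth_along_def
proof (intro ballI)
  fix c d assume c: "c \<in> atlas M" and d: "d \<in> atlas N"
  note o = open_domain[OF c d assms(1)]
  show "smooth_on (snd c ` (fst c \<inter> U \<inter> F -` fst d))
     (\<lambda>y. chart_vec N d (F (chart_inv c y)) (V (chart_inv c y) + W (chart_inv c y)))"
    by (rule smooth_on_cong[OF o _ smooth_on_add[OF _ _ o]], drule domainD(3)[OF c])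
      (use assms(2,3) c d in
        \<open>auto simp: smooth_along_def linear_add[OF linear_chart_vec[OF N d]]\<close>)
qed

lemma smooth_along_scale:
  assumes "open U" "smooth_fun M U f" "smooth_along M N F U V"
  shows "smooth_along M N F U (\<lambda>q. f q *\<^sub>R V q)"
  unfolding smooth_along_def
proof (intro ballI)
  fix c d assume c: "c \<in> atlas M" and d: "d \<in> atlas N"
  let ?S = "snd c ` (fst c \<inter> U \<inter> F -` fst d)"
  note o = open_domain[OF c d assms(1)]
  have "smooth_on ?S (f \<circ> chart_inv c)"
    by (rule smooth_on_mono[where S="snd c ` (fst c \<inter> U)"])
      (use assms(2) c in \<open>auto simp: smooth_fun_def\<close>)
  moreover have "smooth_on ?S (\<lambda>y. chart_vec N d (F (chart_inv c y)) (V (chart_inv c y)))"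
    using assms(3) c d by (simp add: smooth_along_def)
  ultimately show "smooth_on ?S
     (\<lambda>y. chart_vec N d (F (chart_inv c y)) (f (chart_inv c y) *\<^sub>R V (chart_inv c y)))"
    by - (rule smooth_on_cong[OF o _ smooth_on_bilinear[OF bounded_bilinear_scaleR _ _ o]],
      drule domainD(3)[OF c], auto simp: linear_cmul[OF linear_chart_vec[OF N d]])
qed

lemma smooth_along_zero:
  assumes "open U"
  shows "smooth_along M N F U (\<lambda>q. 0)"
  unfolding smooth_along_def
proof (intro ballI)
  fix c d assume c: "c \<in> atlas M" and d: "d \<in> atlas N"
  show "smooth_on (snd c ` (fst c \<inter> U \<inter> F -` fst d)) (\<lambda>y. chart_vec N d (F (chart_inv c y)) 0)"
    by (rule smooth_on_cong[OF open_domain[OF c d assms] _ smooth_on_const[where a=0]],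
        drule domainD(3)[OF c]) (simp add: linear_0[OF linear_chart_vec[OF N d]])
qed

lemma smooth_along_sum:
  assumes "open U"
  shows "(\<And>i. i \<in> I \<Longrightarrow> smooth_along M N F U (V i)) \<Longrightarrow>
    smooth_along M N F U (\<lambda>q. \<Sum>i\<in>I. V i q)"
  by (induction I rule: infinite_finite_induct)
    (simp_all add: assms smooth_along_zero smooth_along_add)

lemma smooth_along_compose:
  assumes "smooth_field N W Y" "open U" "F ` U \<subseteq> W"
  shows "smooth_along M N F U (Y \<circ> F)"
  unfolding smooth_along_def
proof (intro ballI)
  fix c d assume c: "c \<in> atlas M" and d: "d \<in> atlas N"
  let ?S = "snd c ` (fst c \<inter> U \<inter> F -` fst d)" and ?T = "snd d ` (fst d \<inter> W \<inter> id -` fst d)"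
  note o = open_domain[OF c d assms(2)]
  have 1: "smooth_on ?S (snd d \<circ> F \<circ> chart_inv c)"
    by (rule smooth_on_mono[where S="snd c ` (fst c \<inter> F -` fst d)"])
      (use F c d in \<open>auto simp: smooth_map_def\<close>)
  have 2: "smooth_on ?T (\<lambda>z. chart_vec N d (chart_inv d z) (Y (chart_inv d z)))"
    using assms(1) d by (simp add: smooth_along_def)
  have "(snd d \<circ> F \<circ> chart_inv c) ` ?S \<subseteq> ?T"
  proof
    fix z assume "z \<in> (snd d \<circ> F \<circ> chart_inv c) ` ?S"
    then obtain y where y: "y \<in> ?S" "z = snd d (F (chart_inv c y))" by auto
    with domainD[OF c y(1)] assms(3) show "z \<in> ?T" by auto
  qed
  note s = smooth_on_compose[OF o this 1 2]
  show "smooth_on ?S (\<lambda>y. chart_vec N d (F (chart_inv c y)) ((Y \<circ> F) (chart_inv c y)))"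
    by (rule smooth_on_cong[OF o _ s], drule domainD(3)[OF c]) (simp add: atlas_chart(5)[OF N d])
qed

text \<open>In charts this is the Jacobian of \<open>F\<close> applied to the coordinates of
  \<open>X\<close>. Both vary with the point, so the vector is expanded in the basis and only
  partial derivatives in fixed directions remain.\<close>

lemma smooth_along_tangent_map:
  assumes "open U" "smooth_field M U X"
  shows "smooth_along M N F U (\<lambda>q. tangent_map M N F q (X q))"
  unfolding smooth_along_def
proof (intro ballI)
  fix c d assume c: "c \<in> atlas M" and d: "d \<in> atlas N"
  let ?S = "snd c ` (fst c \<inter> U \<inter> F -` fst d)"
  let ?X = "\<lambda>y. chart_vec M c (chart_inv c y) (X (chart_inv c y))"
  let ?h = "\<lambda>y. \<Sum>b\<in>Basis. (?X y \<bullet> b) *\<^sub>R frechet_derivative (snd d \<circ> F \<circ> chart_inv c) (at y) b"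
  note o = open_domain[OF c d assms(1)]
  have 1: "smooth_on ?S ?X"
    by (rule smooth_on_mono[where S="snd c ` (fst c \<inter> U \<inter> id -` fst c)"])
      (use assms(2) c in \<open>auto simp: smooth_along_def\<close>)
  have 2: "smooth_on ?S (\<lambda>y. frechet_derivative (snd d \<circ> F \<circ> chart_inv c) (at y) b)" for b
    by (rule smooth_on_derivative, rule smooth_on_mono[where S="snd c ` (fst c \<inter> F -` fst d)"])
      (use F c d in \<open>auto simp: smooth_map_def\<close>)
  have 3: "smooth_on ?S ?h"
    by (intro smooth_on_sum smooth_on_bilinear[OF bounded_bilinear_scaleR] o 2
        smooth_on_linear[OF bounded_linear_inner_left 1])
  have "?h y = chart_vec N d (F (chart_inv c y))
      (tangent_map M N F (chart_inv c y) (X (chart_inv c y)))" if "y \<in> ?S" for y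
  proof -
    note y = domainD[OF c that]
    show ?thesis
      using linear_euclidean_sum[OF linear_chart_deriv[OF chart_differentiable[OF c d y(1,3)]],
          of "?X y"]
      by (simp add: chart_vec_tangent_map[OF c d y(1,3)] chart_deriv_def y(4))
  qed
  from smooth_on_cong[OF o this 3]
  show "smooth_on ?S (\<lambda>y. chart_vec N d (F (chart_inv c y))
      (tangent_map M N F (chart_inv c y) (X (chart_inv c y))))" .
qed

end

locale connection_on_map = manifold_map M N F
  for M :: "('p::{t2_space, second_countable_topology}, 'd::euclidean_space) manifold"
    and N :: "('q::{t2_space, second_countable_topology}, 'e::euclidean_space) manifold"
    and F :: "'p \<Rightarrow> 'q" +
  fixes D :: "'p \<Rightarrow> 'd \<Rightarrow> ('p \<Rightarrow> 'e) \<Rightarrow> 'e"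
  assumes D: "connection_along M N F D"
begin

lemma
  assumes "open U" "smooth_along M N F U V" "p \<in> U"
  shows connection_linear: "linear (\<lambda>v. D p v V)"
    and connection_cong: "(\<And>q. q \<in> U \<Longrightarrow> W q = V q) \<Longrightarrow> D p v W = D p v V"
    and connection_add: "smooth_along M N F U W \<Longrightarrow> D p v (\<lambda>q. V q + W q) = D p v V + D p v W"
    and connection_scale: "smooth_fun M U f \<Longrightarrow>
      D p v (\<lambda>q. f q *\<^sub>R V q) = dir_deriv M p v f *\<^sub>R V p + f p *\<^sub>R D p v V"
proof -
  note r = D[unfolded connection_along_def, THEN spec[where x=U], THEN spec[where x=V],
      THEN mp, OF conjI[OF assms(1,2)]]
  note r2 = conjunct2[OF conjunct2[OF r]]
  note r3 = conjunct2[OF r2]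
  show "linear (\<lambda>v. D p v V)"
    by (rule bspec[OF conjunct1[OF r] assms(3)])
  show "D p v W = D p v V" if "\<And>q. q \<in> U \<Longrightarrow> W q = V q"
    by (rule conjunct1[OF r2, rule_format, OF assms(3) that])
  show "D p v (\<lambda>q. V q + W q) = D p v V + D p v W" if "smooth_along M N F U W"
    by (rule conjunct1[OF r3, rule_format, OF assms(3) that])
  show "D p v (\<lambda>q. f q *\<^sub>R V q) = dir_deriv M p v f *\<^sub>R V p + f p *\<^sub>R D p v V"
    if "smooth_fun M U f"
    by (rule conjunct2[OF r3, rule_format, OF assms(3) that])
qed

lemma connection_sum:
  assumes "open U" "p \<in> U"
  shows "finite I \<Longrightarrow> (\<And>i. i \<in> I \<Longrightarrow> smooth_along M N F U (V i)) \<Longrightarrow>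
    D p v (\<lambda>q. \<Sum>i\<in>I. V i q) = (\<Sum>i\<in>I. D p v (V i))"
proof (induction I rule: finite_induct)
  case empty
  \<comment> \<open>The zero field is its own double, so additivity forces its derivative to
    vanish.\<close>
  show ?case
    using connection_add[OF assms(1) smooth_along_zero[OF assms(1)] assms(2)
        smooth_along_zero[OF assms(1)], of v] by simp
next
  case (insert i I)
  then show ?case
    using connection_add[OF assms(1) _ assms(2), of "V i" "\<lambda>q. \<Sum>i\<in>I. V i q"]
    by (simp add: smooth_along_sum assms(1))
qed

lemma connection_linear_combination:
  assumes "open U" "p \<in> U" "finite I"
    and "\<And>i. i \<in> I \<Longrightarrow> smooth_fun M U (a i)" "\<And>i. i \<in> I \<Longrightarrow> smooth_along M N F U (E i)"
    and V: "\<And>q. q \<in> U \<Longrightarrow> V q = (\<Sum>i\<in>I. a i q *\<^sub>R E i q)"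
  shows "D p v V = (\<Sum>i\<in>I. dir_deriv M p v (a i) *\<^sub>R E i p + a i p *\<^sub>R D p v (E i))"
proof -
  have s: "smooth_along M N F U (\<lambda>q. a i q *\<^sub>R E i q)" if "i \<in> I" for i
    using assms that by (intro smooth_along_scale)
  have "D p v V = D p v (\<lambda>q. \<Sum>i\<in>I. a i q *\<^sub>R E i q)"
    by (rule connection_cong[OF assms(1) smooth_along_sum[OF assms(1) s] assms(2) V])
  also have "\<dots> = (\<Sum>i\<in>I. D p v (\<lambda>q. a i q *\<^sub>R E i q))"
    by (rule connection_sum[OF assms(1,2,3) s])
  also have "\<dots> = (\<Sum>i\<in>I. dir_deriv M p v (a i) *\<^sub>R E i p + a i p *\<^sub>R D p v (E i))"
    using assms by (intro sum.cong refl connection_scale[where U=U]) auto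
  finally show ?thesis .
qed

end

section \<open>Levi-Civita connections and their pullbacks\<close>

lemma bilinear_left: "bilinear h \<Longrightarrow> linear (\<lambda>x. h x y)"
  and bilinear_right: "bilinear h \<Longrightarrow> linear (h x)"
  by (simp_all add: bilinear_def)

lemma levi_civitaD:
  assumes "levi_civita M g nabla" "open U" "smooth_field M U X" "smooth_field M U Y" "p \<in> U"
  shows levi_civita_torsion: "smooth_fun M U f \<Longrightarrow>
      dir_deriv M p (nabla p (X p) Y - nabla p (Y p) X) f =
        dir_deriv M p (X p) (\<lambda>q. dir_deriv M q (Y q) f)
        - dir_deriv M p (Y p) (\<lambda>q. dir_deriv M q (X q) f)"
    and levi_civita_metric: "dir_deriv M p v (\<lambda>q. g q (X q) (Y q)) =
        g p (nabla p v X) (Y p) + g p (X p) (nabla p v Y)"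
  using assms unfolding levi_civita_def by blast+

text \<open>Vanishing torsion is formulated through the action on functions; testing on coordinate
  functions turns it into a statement on vectors.\<close>

lemma dir_deriv_coordinate:
  assumes "smooth_manifold M" "c \<in> atlas M" "p \<in> fst c"
  shows "dir_deriv M p v (\<lambda>q. snd c q \<bullet> b) = chart_vec M c p v \<bullet> b"
proof -
  let ?d = "chart_at M p"
  have "((\<lambda>q. snd c q \<bullet> b) \<circ> chart_inv ?d has_derivative (\<lambda>v. chart_deriv ?d (snd c) p v \<bullet> b))
      (at (snd ?d p))"
    using bounded_linear.has_derivative[OF bounded_linear_inner_left chart_differentiableD[OF
        chart_differentiable_transition[OF assms(1) chart_at_atlas(1)[OF assms(1)] assms(2)
        chart_at_atlas(2)[OF assms(1)] assms(3)]], of b]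
    by (simp add: o_def)
  from chart_derivI(2)[OF this] show ?thesis
    by (simp add: dir_deriv_eq chart_vec_eq)
qed

lemma dir_deriv_const: "dir_deriv M p v (\<lambda>q. a) = 0"
  by (simp add: dir_deriv_def o_def)

text \<open>Coordinate fields have vanishing bracket: a frame field differentiates each coordinate
  function to a constant, so both iterated derivatives are zero. Hence all coordinates of the
  difference \<open>?w\<close> vanish.\<close>

lemma levi_civita_chart_frame_commute:
  assumes M: "smooth_manifold M" and lc: "levi_civita M g nabla" and c: "c \<in> atlas M" "p \<in> fst c"
  shows "nabla p (chart_frame M c u p) (chart_frame M c v) =
    nabla p (chart_frame M c v p) (chart_frame M c u)"
proof -
  note o = atlas_chart(1)[OF M c(1)]
  let ?w = "nabla p (chart_frame M c u p) (chart_frame M c v) -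
    nabla p (chart_frame M c v p) (chart_frame M c u)"
  have const: "dir_deriv M p x (\<lambda>q. dir_deriv M q (chart_frame M c y q) (\<lambda>q. snd c q \<bullet> b)) = 0"
    for x y b
  proof -
    have "dir_deriv M p x (\<lambda>q. dir_deriv M q (chart_frame M c y q) (\<lambda>q. snd c q \<bullet> b)) =
        dir_deriv M p x (\<lambda>q. y \<bullet> b)"
    proof (rule dir_deriv_cong[OF M o c(2)])
      fix q assume q: "q \<in> fst c"
      show "dir_deriv M q (chart_frame M c y q) (\<lambda>q. snd c q \<bullet> b) = y \<bullet> b"
        by (simp add: dir_deriv_coordinate[OF M c(1) q] chart_vec_chart_frame[OF M c(1) c(1) q q]
            chart_deriv_self[OF M c(1) q])
    qed
    then show ?thesis by (simp add: dir_deriv_const)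
  qed
  have "chart_vec M c p ?w \<bullet> b = 0" for b
    using levi_civita_torsion[OF lc o smooth_field_chart_frame[OF M c(1)]
        smooth_field_chart_frame[OF M c(1)] c(2) smooth_fun_coordinate[OF M c(1)]]
    by (simp add: dir_deriv_coordinate[OF M c] const)
  then have "chart_vec M c p ?w = 0"
    using inner_eq_zero_iff by blast
  then have "?w = chart_frame M c 0 p"
    using chart_frame_chart_vec[OF M c, of ?w] by simp
  then show ?thesis
    using linear_0[OF linear_chart_frame[OF M c]] by simp
qed

text \<open>The existence of a torsion-free connection replaces the symmetry of second derivatives.\<close>

lemma dir_deriv_chart_frame_commute:
  assumes M: "smooth_manifold M" and lc: "levi_civita M g nabla" and c: "c \<in> atlas M"
    and W: "open W" "W \<subseteq> fst c" "smooth_fun M W f" "p \<in> W"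
  shows "dir_deriv M p (chart_frame M c u p) (\<lambda>q. dir_deriv M q (chart_frame M c v q) f) =
    dir_deriv M p (chart_frame M c v p) (\<lambda>q. dir_deriv M q (chart_frame M c u q) f)"
proof -
  have s: "smooth_field M W (chart_frame M c y)" for y
    using smooth_field_chart_frame[OF M c] W(2) by (rule smooth_along_mono)
  have "p \<in> fst c" using W by auto
  \<comment> \<open>The two covariant derivatives of frame fields agree, so the left side of the
    torsion identity is a derivative in the zero direction.\<close>
  from levi_civita_torsion[OF lc W(1) s s W(4,3), of u v]
    levi_civita_chart_frame_commute[OF M lc c this, of u v]
  show ?thesis
    using linear_0[OF linear_dir_deriv[OF M W(3,4)]] by simp
qed

locale pullback_connection_on_map = manifold_map M N F
  for M :: "('p::{t2_space, second_countable_topology}, 'd::euclidean_space) manifold"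
    and N :: "('q::{t2_space, second_countable_topology}, 'e::euclidean_space) manifold"
    and F :: "'p \<Rightarrow> 'q" +
  fixes nabla :: "'q \<Rightarrow> 'e \<Rightarrow> ('q \<Rightarrow> 'e) \<Rightarrow> 'e"
    and D :: "'p \<Rightarrow> 'd \<Rightarrow> ('p \<Rightarrow> 'e) \<Rightarrow> 'e"
  assumes pullback: "pullback_connection M N F nabla D"
    and nabla: "connection_along N N id nabla"
begin

sublocale connection_on_map M N F D
  by unfold_locales (use pullback in \<open>simp add: pullback_connection_def\<close>)

lemma pullback_compose:
  assumes "open W" "smooth_field N W Y" "F p \<in> W"
  shows "D p v (Y \<circ> F) = nabla (F p) (tangent_map M N F p v) Y"
  using pullback assms unfolding pullback_connection_def by blast

text \<open>A linear \<open>A\<close> passes through the frame expansion of \<open>V\<close>, and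
  \<open>A\<close> applied to a frame field is again an ambient field composed with
  \<open>F\<close>, so the pullback axiom evaluates its derivative. The identity and \<phi> are the
  two instances used. \<open>V'\<close> has to agree with the tensor expression on \<open>U\<close>
  only, as \<open>D\<close> is local.\<close>

lemma pullback_tensor_expansion:
  assumes U: "open U" "smooth_along M N F U V" "p \<in> U" and d: "d \<in> atlas N" "F p \<in> fst d"
    and A: "\<And>q. linear (A q)"
      "\<And>b. smooth_field N (fst d) (\<lambda>q. A q (chart_frame N d b q))"
    and V': "\<And>q. q \<in> U \<Longrightarrow> V' q = A (F q) (V q)"
  defines "a \<equiv> \<lambda>b q. chart_vec N d (F q) (V q) \<bullet> b"
  shows "D p v V' =
    (\<Sum>b\<in>Basis. dir_deriv M p v (a b) *\<^sub>R A (F p) (chart_frame N d b (F p)) +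
      a b p *\<^sub>R nabla (F p) (tangent_map M N F p v) (\<lambda>q. A q (chart_frame N d b q)))"
proof -
  let ?W = "U \<inter> F -` fst d" and ?E = "\<lambda>b. (\<lambda>q. A q (chart_frame N d b q)) \<circ> F"
  have W: "open ?W" "p \<in> ?W"
    using U d open_vimage_chart[OF d(1)] by auto
  have e: "V' q = (\<Sum>b\<in>Basis. a b q *\<^sub>R ?E b q)" if "q \<in> ?W" for q
  proof -
    have q: "F q \<in> fst d" using that by auto
    have "A (F q) (V q) =
        A (F q) (\<Sum>b\<in>Basis. (chart_vec N d (F q) (V q) \<bullet> b) *\<^sub>R chart_frame N d b (F q))"
      by (subst chart_frame_expansion[OF N d(1) q]) simp
    then show ?thesis
      using that by (simp add: V' linear_sum[OF A(1)] linear_cmul[OF A(1)] a_def)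
  qed
  have s: "smooth_along M N F ?W (?E b)" for b
    by (rule smooth_along_compose[OF A(2) W(1)]) auto
  have "D p v V' =
      (\<Sum>b\<in>Basis. dir_deriv M p v (a b) *\<^sub>R ?E b p + a b p *\<^sub>R D p v (?E b))"
    by (rule connection_linear_combination[OF W finite_Basis _ s e])
      (simp add: a_def smooth_fun_component[OF U(1,2) d(1)])
  also have "\<dots> = (\<Sum>b\<in>Basis. dir_deriv M p v (a b) *\<^sub>R A (F p) (chart_frame N d b (F p)) +
      a b p *\<^sub>R nabla (F p) (tangent_map M N F p v) (\<lambda>q. A q (chart_frame N d b q)))"
    using pullback_compose[OF atlas_chart(1)[OF N d(1)] A(2) d(2)]
    by (intro sum.cong) auto
  finally show ?thesis .
qed

text \<open>The identity tensor; in particular \<open>D\<close> is determined by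
  \<open>nabla\<close> on smooth fields.\<close>

lemma pullback_expansion:
  assumes "open U" "smooth_along M N F U V" "p \<in> U" "d \<in> atlas N" "F p \<in> fst d"
  shows "D p v V = (\<Sum>b\<in>Basis.
      dir_deriv M p v (\<lambda>q. chart_vec N d (F q) (V q) \<bullet> b) *\<^sub>R chart_frame N d b (F p) +
      (chart_vec N d (F p) (V p) \<bullet> b) *\<^sub>R
        nabla (F p) (tangent_map M N F p v) (chart_frame N d b))"
  using pullback_tensor_expansion[OF assms, of "\<lambda>q x. x" V v]
    smooth_field_chart_frame[OF N assms(4)] by (simp add: linear_id[unfolded id_def])

text \<open>Absence of torsion along \<open>F\<close>. The derivatives of the components are second
  derivatives of the map in coordinates, hence symmetric in \<open>u\<close> and \<open>v\<close>;
  the remaining terms are symmetric because \<open>nabla\<close> commutes on the coordinate fields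
  of the target.\<close>

lemma pullback_tangent_map_commute:
  assumes lcM: "levi_civita M h nablaM" and lcN: "levi_civita N g nabla"
    and c: "c \<in> atlas M" "p \<in> fst c"
  shows "D p (chart_frame M c u p) (\<lambda>q. tangent_map M N F q (chart_frame M c v q)) =
    D p (chart_frame M c v p) (\<lambda>q. tangent_map M N F q (chart_frame M c u q))"
proof -
  define d where "d = chart_at N (F p)"
  have d: "d \<in> atlas N" "F p \<in> fst d"
    using chart_at_atlas[OF N] by (auto simp: d_def)
  define G where "G = chart_frame N d"
  define E where "E = (\<lambda>v q. tangent_map M N F q (chart_frame M c v q))"
  define a where "a = (\<lambda>v b q. chart_vec N d (F q) (E v q) \<bullet> b)"
  define W where "W = fst c \<inter> F -` fst d"
  have W: "open W" "p \<in> W" "W \<subseteq> fst c"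
    using c d open_vimage_chart[OF d(1)] atlas_chart(1)[OF M c(1)] by (auto simp: W_def)
  have E: "smooth_along M N F (fst c) (E v)" for v
    unfolding E_def
    by (rule smooth_along_tangent_map[OF atlas_chart(1)[OF M c(1)] smooth_field_chart_frame[OF M c(1)]])
  have f: "smooth_fun M W (\<lambda>q. snd d (F q) \<bullet> b)" for b
    unfolding smooth_fun_def
  proof
    fix e assume e: "e \<in> atlas M"
    have "smooth_on (snd e ` (fst e \<inter> F -` fst d)) (snd d \<circ> F \<circ> chart_inv e)"
      using F e d by (simp add: smooth_map_def)
    from smooth_on_linear[OF bounded_linear_inner_left this
        open_chart_image[OF M e open_vimage_chart[OF d(1)]]]
    have "smooth_on (snd e ` (fst e \<inter> F -` fst d)) (\<lambda>y. (snd d \<circ> F \<circ> chart_inv e) y \<bullet> b)" .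
    from smooth_on_mono[OF this, of "snd e ` (fst e \<inter> W)"]
    show "smooth_on (snd e ` (fst e \<inter> W)) ((\<lambda>q. snd d (F q) \<bullet> b) \<circ> chart_inv e)"
      by (auto simp: W_def o_def)
  qed
  \<comment> \<open>The components of the image of a coordinate field are first derivatives of the
    coordinates of \<open>F\<close>.\<close>
  have a: "a v b q = dir_deriv M q (chart_frame M c v q) (\<lambda>q. snd d (F q) \<bullet> b)"
    if "q \<in> W" for v b q
  proof -
    have q: "q \<in> fst c" "F q \<in> fst d" using that by (auto simp: W_def)
    have D: "chart_differentiable (chart_at N (F q)) (\<lambda>z. snd d z \<bullet> b) (F q)"
      using smooth_fun_chart_differentiable[OF smooth_fun_coordinate[OF N d(1)] q(2)
          chart_at_atlas[OF N]] .
    show ?thesis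
      using dir_deriv_comp[OF D] dir_deriv_coordinate[OF N d(1) q(2)]
      by (simp add: a_def E_def o_def)
  qed
  have comm: "dir_deriv M p (chart_frame M c u p) (a v b) = dir_deriv M p (chart_frame M c v p) (a u b)"
    for u v b
    using dir_deriv_chart_frame_commute[OF M lcM c(1) W(1,3) f[of b] W(2), of u v]
      dir_deriv_cong[OF M W(1,2) a] by simp
  have lin: "linear (\<lambda>w. nabla (F p) w (G b))" for b
    unfolding G_def
    by (rule connection_on_map.connection_linear[OF _ atlas_chart(1)[OF N d(1)]
          smooth_field_chart_frame[OF N d(1)] d(2)])
      (use manifold_map_id[OF N] nabla in \<open>auto simp: connection_on_map_def connection_on_map_axioms_def\<close>)
  have exp: "D p (chart_frame M c u p) (E v) =
      (\<Sum>b\<in>Basis. dir_deriv M p (chart_frame M c u p) (a v b) *\<^sub>R G b (F p)) +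
      (\<Sum>b\<in>Basis. \<Sum>b'\<in>Basis. (a v b p * a u b' p) *\<^sub>R nabla (F p) (G b' (F p)) (G b))" for u v
  proof -
    have "E u p = (\<Sum>b'\<in>Basis. a u b' p *\<^sub>R G b' (F p))"
      unfolding a_def G_def by (rule chart_frame_expansion[OF N d])
    then have "nabla (F p) (E u p) (G b) =
        (\<Sum>b'\<in>Basis. a u b' p *\<^sub>R nabla (F p) (G b' (F p)) (G b))" for b
      by (simp add: linear_sum[OF lin] linear_cmul[OF lin])
    then show ?thesis
      using pullback_expansion[OF atlas_chart(1)[OF M c(1)] E c(2) d, of "chart_frame M c u p" v]
      by (simp add: a_def G_def E_def sum.distrib scaleR_sum_right)
  qed
  \<comment> \<open>Exchanging the summation indices exchanges the roles of \<open>u\<close> and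
    \<open>v\<close> up to the order of the two frame fields in \<open>nabla\<close>.\<close>
  have "(\<Sum>b\<in>Basis. \<Sum>b'\<in>Basis. (a v b p * a u b' p) *\<^sub>R nabla (F p) (G b' (F p)) (G b)) =
      (\<Sum>b\<in>Basis. \<Sum>b'\<in>Basis. (a u b p * a v b' p) *\<^sub>R nabla (F p) (G b' (F p)) (G b))"
    by (subst sum.swap) (simp add: G_def mult.commute
        levi_civita_chart_frame_commute[OF N lcN d, of _ "_"])
  then have "D p (chart_frame M c u p) (E v) = D p (chart_frame M c v p) (E u)"
    by (simp only: exp comm[of u v])
  then show ?thesis by (simp add: E_def)
qed

end

section \<open>Metric compatibility, the Kenmotsu equation and the Gauss formula along a map\<close>

lemma riemannian_manifoldD:
  assumes "riemannian_manifold M g"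
  shows "smooth_manifold M" "bilinear (g p)" "g p u v = g p v u" "g p u u = 0 \<longleftrightarrow> u = 0"
    "open U \<Longrightarrow> smooth_field M U X \<Longrightarrow> smooth_field M U Y \<Longrightarrow> smooth_fun M U (\<lambda>p. g p (X p) (Y p))"
proof -
  note r = assms[unfolded riemannian_manifold_def]
  show "smooth_manifold M" using r by (rule conjunct1)
  show b: "bilinear (g p)" and "g p u v = g p v u"
    using r by (blast+)
  show "g p u u = 0 \<longleftrightarrow> u = 0"
    using r bilinear_lzero[OF b] by (metis less_irrefl)
  show "smooth_fun M U (\<lambda>p. g p (X p) (Y p))"
    if "open U" "smooth_field M U X" "smooth_field M U Y"
    using conjunct2[OF conjunct2[OF r]] that by blast
qed

context pullback_connection_on_map
begin

text \<open>In a frame, the inner product is a sum of two components times a metric coefficient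
  \<open>k\<close> composed with \<open>F\<close>. Only the coefficient needs the metric property of
  \<open>nabla\<close>, applied in the direction of the image of \<open>v\<close>.\<close>

lemma pullback_metric:
  assumes g: "riemannian_manifold N g" and lc: "levi_civita N g nabla"
    and U: "open U" "p \<in> U" and V: "smooth_along M N F U V" and W: "smooth_along M N F U W"
  shows "dir_deriv M p v (\<lambda>q. g (F q) (V q) (W q)) =
    g (F p) (D p v V) (W p) + g (F p) (V p) (D p v W)"
proof -
  define d where "d = chart_at N (F p)"
  have d: "d \<in> atlas N" "F p \<in> fst d"
    using chart_at_atlas[OF N] by (auto simp: d_def)
  define G where "G = chart_frame N d"
  define a where "a = (\<lambda>V b q. chart_vec N d (F q) (V q :: 'e) \<bullet> b)"
  define k where "k = (\<lambda>i q. g q (G (fst i) q) (G (snd i) q))"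
  let ?U = "U \<inter> F -` fst d" and ?I = "Basis \<times> Basis :: ('e \<times> 'e) set"
  let ?c = "chart_at M p" and ?w = "tangent_map M N F p v"
  have U': "open ?U" "p \<in> ?U"
    using U d open_vimage_chart[OF d(1)] by auto
  note bil = riemannian_manifoldD(2)[OF g]
  note at = chart_at_atlas[OF M, of p]
  have G: "smooth_field N (fst d) (G b)" for b
    unfolding G_def by (rule smooth_field_chart_frame[OF N d(1)])
  note od = atlas_chart(1)[OF N d(1)]
  have k: "chart_differentiable ?c (k i \<circ> F) p"
    "dir_deriv M p v (k i \<circ> F) = dir_deriv N (F p) ?w (k i)" for i
  proof -
    have "chart_differentiable (chart_at N (F p)) (k i) (F p)"
      unfolding k_def
      by (rule smooth_fun_chart_differentiable[OF riemannian_manifoldD(5)[OF g od G G]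
            d(2) chart_at_atlas[OF N]])
    then show "chart_differentiable ?c (k i \<circ> F) p"
      "dir_deriv M p v (k i \<circ> F) = dir_deriv N (F p) ?w (k i)"
      using chain(1)[OF at chart_at_atlas[OF N] at(1) chart_at_atlas(1)[OF N] at(2) chart_at_atlas(2)[OF N]]
        dir_deriv_comp by auto
  qed
  have a: "chart_differentiable ?c (a V b) p" if "smooth_along M N F U V" for V b
    unfolding a_def
    by (rule smooth_fun_chart_differentiable[OF smooth_fun_component[OF U(1) that d(1)] U'(2) at])
  have expand: "V q = (\<Sum>b\<in>Basis. a V b q *\<^sub>R G b (F q))" if "q \<in> ?U" for V q
    unfolding a_def G_def using that by (intro chart_frame_expansion[OF N d(1)]) auto
  \<comment> \<open>Stated for arbitrary coefficients, vectors and base point: it serves the fields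
    near \<open>p\<close> as well as their covariant derivatives at \<open>p\<close>.\<close>
  have pair: "g (F p) (\<Sum>b\<in>Basis. x b *\<^sub>R y b) (\<Sum>b\<in>Basis. x' b *\<^sub>R y' b) =
      (\<Sum>i\<in>?I. x (fst i) * x' (snd i) * g (F p) (y (fst i)) (y' (snd i)))" for x y x' y' p
    by (simp add: bilinear_sum[OF bil] bilinear_lmul[OF bil] bilinear_rmul[OF bil]
        case_prod_beta mult_ac)
  have eq: "g (F q) (V q) (W q) = (\<Sum>i\<in>?I. (a V (fst i) q * a W (snd i) q) * (k i \<circ> F) q)"
    if "q \<in> ?U" for q
    by (subst expand[OF that, of V], subst expand[OF that, of W]) (simp add: pair k_def)
  have "dir_deriv M p v (\<lambda>q. g (F q) (V q) (W q)) =
      dir_deriv M p v (\<lambda>q. \<Sum>i\<in>?I. (a V (fst i) q * a W (snd i) q) * (k i \<circ> F) q)"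
    by (rule dir_deriv_cong[OF M U' eq])
  also have "\<dots> = (\<Sum>i\<in>?I. (a V (fst i) p * a W (snd i) p) * dir_deriv M p v (k i \<circ> F) +
      (a V (fst i) p * dir_deriv M p v (a W (snd i)) +
       dir_deriv M p v (a V (fst i)) * a W (snd i) p) * (k i \<circ> F) p)"
    unfolding dir_deriv_eq
    by (subst chart_deriv_sum(2), (intro chart_deriv_mult(1)[OF M at] a V W k)[1],
        intro sum.cong refl, subst chart_deriv_mult(2)[OF M at chart_deriv_mult(1)[OF M at] k(1)])
      (intro a V W | simp add: chart_deriv_mult(2)[OF M at a[OF V] a[OF W]])+
  \<comment> \<open>The summands are grouped so that the first two make up the derivative of
    \<open>V\<close> and the last two that of \<open>W\<close>.\<close>
  also have "\<dots> = (\<Sum>i\<in>?I.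
      dir_deriv M p v (a V (fst i)) * a W (snd i) p * g (F p) (G (fst i) (F p)) (G (snd i) (F p)) +
      a V (fst i) p * a W (snd i) p * g (F p) (nabla (F p) ?w (G (fst i))) (G (snd i) (F p)) +
      (a V (fst i) p * dir_deriv M p v (a W (snd i)) * g (F p) (G (fst i) (F p)) (G (snd i) (F p)) +
      a V (fst i) p * a W (snd i) p * g (F p) (G (fst i) (F p)) (nabla (F p) ?w (G (snd i)))))"
    by (intro sum.cong refl)
      (simp add: k(2), simp add: k_def levi_civita_metric[OF lc od G G d(2)] algebra_simps)
  also have "\<dots> = g (F p) (D p v V) (W p) + g (F p) (V p) (D p v W)"
  proof -
    have D: "D p v V = (\<Sum>b\<in>Basis. dir_deriv M p v (a V b) *\<^sub>R G b (F p)) +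
        (\<Sum>b\<in>Basis. a V b p *\<^sub>R nabla (F p) ?w (G b))" if "smooth_along M N F U V" for V
      using pullback_expansion[OF U(1) that U(2) d]
      by (simp add: a_def G_def sum.distrib)
    show ?thesis
      by (subst expand[OF U'(2), of W], subst expand[OF U'(2), of V])
        (simp add: D[OF V] D[OF W] bilinear_ladd[OF bil] bilinear_radd[OF bil] pair sum.distrib)
  qed
  finally show ?thesis .
qed

text \<open>The Kenmotsu equation holds on frame fields of the target. Its correction terms depend
  linearly on the value of the differentiated field, so the frame components reassemble to
  \<open>V p\<close>.\<close>

lemma pullback_kenmotsu:
  assumes K: "kenmotsu N \<phi> \<xi> \<eta> g nabla"
    and U: "open U" "smooth_along M N F U V" "p \<in> U"
    and V': "\<And>q. q \<in> U \<Longrightarrow> V' q = \<phi> (F q) (V q)"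
  shows "D p v V' = \<phi> (F p) (D p v V) +
    g (F p) (\<phi> (F p) (tangent_map M N F p v)) (V p) *\<^sub>R \<xi> (F p) -
    \<eta> (F p) (V p) *\<^sub>R \<phi> (F p) (tangent_map M N F p v)"
proof -
  have acm: "almost_contact_metric N \<phi> \<xi> \<eta> g"
    and eq: "\<And>U X Y p. open U \<Longrightarrow> smooth_field N U X \<Longrightarrow> smooth_field N U Y \<Longrightarrow> p \<in> U \<Longrightarrow>
      nabla p (X p) (\<lambda>q. \<phi> q (Y q)) - \<phi> p (nabla p (X p) Y) =
        g p (\<phi> p (X p)) (Y p) *\<^sub>R \<xi> p - \<eta> p (Y p) *\<^sub>R \<phi> p (X p)"
    using K unfolding kenmotsu_def by blast+
  have lin: "linear (\<phi> q)" "linear (\<eta> q)" "bilinear (g q)" for q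
    using acm by (simp_all add: almost_contact_metric_def riemannian_manifold_def)
  have sm: "smooth_field N U (\<lambda>q. \<phi> q (X q))" if "open U" "smooth_field N U X" for U X
    using acm that unfolding almost_contact_metric_def by blast
  define d where "d = chart_at N (F p)"
  have d: "d \<in> atlas N" "F p \<in> fst d"
    using chart_at_atlas[OF N] by (auto simp: d_def)
  define G where "G = chart_frame N d"
  define a where "a = (\<lambda>b q. chart_vec N d (F q) (V q) \<bullet> b)"
  let ?w = "tangent_map M N F p v"
  have G: "smooth_field N (fst d) (G b)" for b
    unfolding G_def by (rule smooth_field_chart_frame[OF N d(1)])
  note od = atlas_chart(1)[OF N d(1)]
  have V: "V p = (\<Sum>b\<in>Basis. a b p *\<^sub>R G b (F p))"
    unfolding a_def G_def by (rule chart_frame_expansion[OF N d])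
  \<comment> \<open>The Kenmotsu equation takes its direction from a smooth field, so the image of
    \<open>v\<close> is extended by the field with the same constant coordinates.\<close>
  have w: "?w = G (chart_vec N d (F p) ?w) (F p)"
    unfolding G_def by (simp add: chart_frame_chart_vec[OF N d])
  have phi_frame: "nabla (F p) ?w (\<lambda>q. \<phi> q (G b q)) = \<phi> (F p) (nabla (F p) ?w (G b)) +
      (g (F p) (\<phi> (F p) ?w) (G b (F p)) *\<^sub>R \<xi> (F p) - \<eta> (F p) (G b (F p)) *\<^sub>R \<phi> (F p) ?w)" for b
    using eq[OF od G G d(2), of "chart_vec N d (F p) ?w" b]
    by (simp add: w[symmetric] algebra_simps)
  have "D p v V' =
    (\<Sum>b\<in>Basis. dir_deriv M p v (a b) *\<^sub>R \<phi> (F p) (G b (F p)) +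
      a b p *\<^sub>R nabla (F p) ?w (\<lambda>q. \<phi> q (G b q)))"
    unfolding a_def G_def
    by (rule pullback_tensor_expansion[OF U d lin(1) sm[OF od G[unfolded G_def]] V'])
  also have "\<dots> = (\<Sum>b\<in>Basis. \<phi> (F p) (dir_deriv M p v (a b) *\<^sub>R G b (F p) +
      a b p *\<^sub>R nabla (F p) ?w (G b))) +
      ((\<Sum>b\<in>Basis. a b p * g (F p) (\<phi> (F p) ?w) (G b (F p))) *\<^sub>R \<xi> (F p) -
      (\<Sum>b\<in>Basis. a b p * \<eta> (F p) (G b (F p))) *\<^sub>R \<phi> (F p) ?w)"
    by (simp add: phi_frame linear_add[OF lin(1)] linear_cmul[OF lin(1)] scaleR_sum_left
        sum.distrib sum_subtractf algebra_simps)
  also have "(\<Sum>b\<in>Basis. \<phi> (F p) (dir_deriv M p v (a b) *\<^sub>R G b (F p) +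
      a b p *\<^sub>R nabla (F p) ?w (G b))) = \<phi> (F p) (D p v V)"
    using pullback_expansion[OF U d] by (simp add: linear_sum[OF lin(1)] a_def G_def)
  also have "(\<Sum>b\<in>Basis. a b p * g (F p) (\<phi> (F p) ?w) (G b (F p))) = g (F p) (\<phi> (F p) ?w) (V p)"
    unfolding V using bilinear_right[OF lin(3)] by (simp add: linear_sum linear_cmul)
  also have "(\<Sum>b\<in>Basis. a b p * \<eta> (F p) (G b (F p))) = \<eta> (F p) (V p)"
    unfolding V by (simp add: linear_sum[OF lin(2)] linear_cmul[OF lin(2)])
  finally show ?thesis by simp
qed

text \<open>The difference \<open>S u v w\<close> of both sides on coordinate fields is symmetric in
  \<open>u, v\<close> since both connections are torsion free, and antisymmetric in \<open>v, w\<close> since both are metric;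
  hence it vanishes.\<close>

lemma gauss_formula:
  assumes g: "riemannian_manifold N g" and lcN: "levi_civita N g nabla"
    and lcM: "levi_civita M (induced_metric M N F g) nablaM"
    and U: "open U" "smooth_field M U Z" "p \<in> U"
  shows "g (F p) (D p u (\<lambda>q. tangent_map M N F q (Z q))) (tangent_map M N F p w) =
    g (F p) (tangent_map M N F p (nablaM p u Z)) (tangent_map M N F p w)"
proof -
  define c where "c = chart_at M p"
  have c: "c \<in> atlas M" "p \<in> fst c"
    using chart_at_atlas[OF M] by (auto simp: c_def)
  note oc = atlas_chart(1)[OF M c(1)]
  define E where "E = chart_frame M c"
  let ?T = "tangent_map M N F" and ?h = "g (F p)"
  note bil = riemannian_manifoldD(2)[OF g] and lT = linear_tangent_map
  have E: "smooth_field M (fst c) (E v)" for v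
    unfolding E_def by (rule smooth_field_chart_frame[OF M c(1)])
  have TE: "smooth_along M N F (fst c) (\<lambda>q. ?T q (E v q))" for v
    by (rule smooth_along_tangent_map[OF oc E])
  \<comment> \<open>Since \<open>c\<close> is the selected chart at \<open>p\<close>, vectors at
    \<open>p\<close> are their own coordinates; the frame thus extends every vector at
    \<open>p\<close>.\<close>
  have E_p: "E v p = v" for v
    by (simp add: E_def chart_frame_def c_def chart_deriv_self[OF M chart_at_atlas[OF M]])
  define S where "S = (\<lambda>u v w. ?h (D p u (\<lambda>q. ?T q (E v q))) (?T p w) - ?h (?T p (nablaM p u (E v))) (?T p w))"
  have sym: "S u v w = S v u w" for u v w
    using pullback_tangent_map_commute[OF lcM lcN c, of u v]
      levi_civita_chart_frame_commute[OF M lcM c, of u v]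
    by (simp add: S_def E_def[symmetric] E_p)
  \<comment> \<open>The metric on \<open>M\<close> is induced, so both compatibility identities
    differentiate the same function; their difference is the claim.\<close>
  have anti: "S u v w = - S u w v" for u v w
    using pullback_metric[OF g lcN oc c(2) TE TE, of u v w]
      levi_civita_metric[OF lcM oc E E c(2), of u v w]
      riemannian_manifoldD(3)[OF g]
    by (simp add: S_def induced_metric_def E_p)
  \<comment> \<open>Alternating the two symmetries runs through all six orders of the arguments and
    returns after three sign changes, so \<open>S u v w\<close> equals its own negative.\<close>
  have S: "S u v w = 0" for u v w
    using anti[of u v w] sym[of u w v] anti[of w u v] sym[of w v u] anti[of v w u] sym[of v u w]
    by simp
  let ?U = "U \<inter> fst c"
  define z where "z = (\<lambda>b q. chart_vec M c q (Z q) \<bullet> b)"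
  have U': "open ?U" "p \<in> ?U" using U oc c by auto
  have z: "smooth_fun M ?U (z b)" for b
    using manifold_map.smooth_fun_component[OF manifold_map_id[OF M] U(1,2) c(1), of b]
    by (simp add: z_def)
  have Z: "Z q = (\<Sum>b\<in>Basis. z b q *\<^sub>R E b q)" if "q \<in> ?U" for q
    unfolding z_def E_def using that by (intro chart_frame_expansion[OF M c(1)]) auto
  have TZ: "?T q (Z q) = (\<Sum>b\<in>Basis. z b q *\<^sub>R ?T q (E b q))" if "q \<in> ?U" for q
    by (subst Z[OF that]) (simp add: linear_sum[OF lT] linear_cmul[OF lT])
  have DZ: "D p u (\<lambda>q. ?T q (Z q)) =
      (\<Sum>b\<in>Basis. dir_deriv M p u (z b) *\<^sub>R ?T p (E b p) + z b p *\<^sub>R D p u (\<lambda>q. ?T q (E b q)))"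
    by (rule connection_linear_combination[OF U' finite_Basis z smooth_along_mono[OF TE] TZ]) auto
  have "connection_on_map M M id nablaM"
    using manifold_map_id[OF M] lcM
    by (simp add: connection_on_map_def connection_on_map_axioms_def levi_civita_def)
  from connection_on_map.connection_linear_combination[OF this U' finite_Basis z
      smooth_along_mono[OF E] Z, of u]
  have nZ: "nablaM p u Z = (\<Sum>b\<in>Basis. dir_deriv M p u (z b) *\<^sub>R E b p + z b p *\<^sub>R nablaM p u (E b))"
    by simp
  \<comment> \<open>The expansions of \<open>D\<close> and \<open>nablaM\<close> share their terms
    with derivatives of coefficients, so agreement on frame fields suffices for
    \<open>Z\<close>.\<close>
  have "?h (D p u (\<lambda>q. ?T q (E b q))) (?T p w) = ?h (?T p (nablaM p u (E b))) (?T p w)" for b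
    using S[of u b w] by (simp add: S_def)
  then show ?thesis
    unfolding DZ nZ
    by (simp add: linear_sum[OF bilinear_left[OF bil]] linear_add[OF bilinear_left[OF bil]]
        linear_cmul[OF bilinear_left[OF bil]] linear_sum[OF lT] linear_add[OF lT] linear_cmul[OF lT])
qed

end
section \<open>Normal parts and products\<close>

context manifold_map
begin

text \<open>Two candidates differ by a vector that is both tangent and normal, hence orthogonal to
  itself.\<close>

lemma normal_part_unique:
  assumes g: "riemannian_manifold N g"
    and n: "n \<in> normal_space M N F g p" "w - n \<in> range (tangent_map M N F p)"
  shows "normal_part M N F g p w = n"
  unfolding normal_part_def
proof (rule the_equality)
  fix m assume m: "m \<in> normal_space M N F g p \<and> w - m \<in> range (tangent_map M N F p)"
  then obtain u v where uv: "w - m = tangent_map M N F p u" "w - n = tangent_map M N F p v"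
    using n(2) by blast
  have "m - n = (w - n) - (w - m)" by simp
  then have t: "m - n = tangent_map M N F p (v - u)"
    by (simp only: uv linear_diff[OF linear_tangent_map])
  have "g (F p) (m - n) (tangent_map M N F p (v - u)) = 0"
    using m n(1) by (simp add: normal_space_def bilinear_lsub[OF riemannian_manifoldD(2)[OF g]])
  then have "m - n = 0"
    unfolding t[symmetric] riemannian_manifoldD(4)[OF g] .
  then show "m = n" by simp
qed (use n in simp)

text \<open>Orthogonal projection for an arbitrary inner product: the tangential part solves a
  linear system whose operator is injective by definiteness and \<open>inj\<close>, hence surjective
  in finite dimension.\<close>

lemma normal_part:
  assumes g: "riemannian_manifold N g" and inj: "inj (tangent_map M N F p)"
  shows "normal_part M N F g p w \<in> normal_space M N F g p"
    and "w - normal_part M N F g p w \<in> range (tangent_map M N F p)"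
proof -
  let ?T = "tangent_map M N F p" and ?h = "g (F p)"
  note bil = riemannian_manifoldD(2)[OF g, of "F p"] and lT = linear_tangent_map[of p]
  \<comment> \<open>The Gram operator of the induced inner product relative to the Euclidean one on
    the coordinate space.\<close>
  define A where "A = (\<lambda>u. \<Sum>b\<in>Basis. ?h (?T u) (?T b) *\<^sub>R b)"
  have A_inner: "A u \<bullet> v = ?h (?T u) (?T v)" for u v
    using linear_euclidean_sum[OF linear_compose[OF lT bilinear_right[OF bil, of "?T u"]], of v]
    by (simp add: A_def inner_sum_left inner_sum_right o_def inner_commute mult.commute)
  have "linear A"
    unfolding A_def
    by (intro linearI)
      (simp_all add: linear_add[OF lT] linear_cmul[OF lT] bilinear_ladd[OF bil] bilinear_lmul[OF bil]
        sum.distrib scaleR_add_left scaleR_sum_right)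
  moreover have "u = 0" if "A u = 0" for u
    using A_inner[of u u] that riemannian_manifoldD(4)[OF g] inj linear_injective_0[OF lT] by simp
  ultimately have "surj A"
    by (simp add: linear_injective_imp_surjective linear_injective_0)
  \<comment> \<open>The right side represents the functional pairing \<open>w\<close> with tangent
    vectors, so \<open>?T u\<close> is the tangential part of \<open>w\<close>.\<close>
  then obtain u where u: "A u = (\<Sum>b\<in>Basis. ?h w (?T b) *\<^sub>R b)"
    by (metis surjD)
  have "?h (?T u) (?T v) = ?h w (?T v)" for v
    using linear_euclidean_sum[OF linear_compose[OF lT bilinear_right[OF bil, of w]], of v]
    by (simp add: A_inner[symmetric] u inner_sum_left inner_sum_right o_def inner_commute mult.commute)
  then have n: "w - ?T u \<in> normal_space M N F g p" "w - (w - ?T u) \<in> range ?T"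
    by (simp_all add: normal_space_def bilinear_lsub[OF bil])
  then show "normal_part M N F g p w \<in> normal_space M N F g p"
    and "w - normal_part M N F g p w \<in> range ?T"
    by (simp_all only: normal_part_unique[OF g n])
qed

text \<open>The part removed by the projection is tangent, hence orthogonal to
  \<open>n\<close>.\<close>

lemma normal_part_inner:
  assumes g: "riemannian_manifold N g" and inj: "inj (tangent_map M N F p)"
    and n: "n \<in> normal_space M N F g p"
  shows "g (F p) (normal_part M N F g p w) n = g (F p) w n"
proof -
  obtain u where u: "w - normal_part M N F g p w = tangent_map M N F p u"
    using normal_part(2)[OF g inj] by blast
  have "g (F p) (w - normal_part M N F g p w) n = 0"
    using n riemannian_manifoldD(3)[OF g] by (simp add: u normal_space_def)
  then show ?thesis
    by (simp add: bilinear_lsub[OF riemannian_manifoldD(2)[OF g]])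
qed

end

section \<open>Slices of a product manifold\<close>

lemma chart_inv_prod_chart:
  assumes "smooth_manifold M1" "c1 \<in> atlas M1" "p \<in> fst c1"
    and "smooth_manifold M2" "c2 \<in> atlas M2" "q \<in> fst c2"
  shows "chart_inv (prod_chart c1 c2) (snd c1 p, snd c2 q) = (p, q)"
proof -
  have "inj_on (snd c1) (fst c1)" "inj_on (snd c2) (fst c2)"
    using assms atlas_chart(5) by (metis inj_on_inverseI)+
  then have "inj_on (map_prod (snd c1) (snd c2)) (fst c1 \<times> fst c2)"
    by (rule map_prod_inj_on)
  from inv_into_f_f[OF this, of "(p, q)"] show ?thesis
    using assms by (simp add: chart_inv_def prod_chart_def)
qed

text \<open>Anti-invariance is assumed for each slice as a submanifold of its own; this carries it
  over to vectors tangent to the product. It holds because the selected chart of the product is the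
  product of the selected charts, so the inclusion of the slice is affine in coordinates.\<close>

lemma tangent_map_slice:
  assumes M1: "smooth_manifold M1" and M2: "smooth_manifold M2"
    and \<iota>: "manifold_map (prod_manifold M1 M2) N \<iota>"
  shows "tangent_map M2 N (\<lambda>q. \<iota> (p, q)) q v = tangent_map (prod_manifold M1 M2) N \<iota> (p, q) (0, v)"
proof -
  let ?P = "prod_manifold M1 M2"
  define c1 where "c1 = chart_at M1 p"
  define c2 where "c2 = chart_at M2 q"
  define d where "d = chart_at N (\<iota> (p, q))"
  have c1: "c1 \<in> atlas M1" "p \<in> fst c1" and c2: "c2 \<in> atlas M2" "q \<in> fst c2"
    using chart_at_atlas[OF M1] chart_at_atlas[OF M2] by (auto simp: c1_def c2_def)
  have at: "chart_at ?P (p, q) = prod_chart c1 c2"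
    by (simp add: prod_manifold_def c1_def c2_def)
  have P: "smooth_manifold ?P" and N: "smooth_manifold N"
    using \<iota> by (simp_all add: manifold_map_def)
  have "chart_differentiable (prod_chart c1 c2) (snd d \<circ> \<iota>) (p, q)"
    unfolding at[symmetric] d_def
    by (intro manifold_map.chart_differentiable[OF \<iota>] chart_at_atlas P N)
  from chart_differentiableD[OF this]
  have 1: "((snd d \<circ> \<iota> \<circ> chart_inv (prod_chart c1 c2)) has_derivative
      chart_deriv (prod_chart c1 c2) (snd d \<circ> \<iota>) (p, q)) (at (snd c1 p, snd c2 q))"
    by (simp add: prod_chart_def)
  have "((\<lambda>y. (snd c1 p, y)) has_derivative (\<lambda>v. (0, v))) (at (snd c2 q))"
    by (intro derivative_intros)
  from diff_chain_at[OF this 1]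
  have "((\<lambda>y. (snd d \<circ> \<iota> \<circ> chart_inv (prod_chart c1 c2)) (snd c1 p, y)) has_derivative
      (\<lambda>v. chart_deriv (prod_chart c1 c2) (snd d \<circ> \<iota>) (p, q) (0, v))) (at (snd c2 q))"
    by (simp add: o_def)
  then have "((snd d \<circ> (\<lambda>q. \<iota> (p, q)) \<circ> chart_inv c2) has_derivative
      (\<lambda>v. chart_deriv (prod_chart c1 c2) (snd d \<circ> \<iota>) (p, q) (0, v))) (at (snd c2 q))"
    by (subst (asm) has_derivative_cong_open[OF atlas_chart(2)[OF M2 c2(1)],
          where g="snd d \<circ> (\<lambda>q. \<iota> (p, q)) \<circ> chart_inv c2"])
      (use c2 in \<open>auto simp: chart_inv_prod_chart[OF M1 c1 M2 c2(1)] atlas_chart(5)[OF M2 c2(1)]\<close>)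
  from chart_derivI(2)[OF this] show ?thesis
    by (simp add: tangent_map_eq at c2_def[symmetric] d_def[symmetric])
qed

section \<open>The covariant derivative of \<open>N\<close> on the warped product\<close>

theorem theorem4p4:
  fixes Q :: "('m::{t2_space, second_countable_topology}, 'e::euclidean_space) manifold"
    and \<phi> :: "'m \<Rightarrow> 'e \<Rightarrow> 'e" and \<xi> :: "'m \<Rightarrow> 'e" and \<eta> :: "'m \<Rightarrow> 'e \<Rightarrow> real"
    and g :: "'m \<Rightarrow> 'e \<Rightarrow> 'e \<Rightarrow> real"
    and nablaQ :: "'m \<Rightarrow> 'e \<Rightarrow> ('m \<Rightarrow> 'e) \<Rightarrow> 'e"
    and NT :: "('p::{t2_space, second_countable_topology}, 'c::euclidean_space) manifold"
    and gT :: "'p \<Rightarrow> 'c \<Rightarrow> 'c \<Rightarrow> real"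
    and NP :: "('q::{t2_space, second_countable_topology}, 'd::euclidean_space) manifold"
    and gP :: "'q \<Rightarrow> 'd \<Rightarrow> 'd \<Rightarrow> real"
    and f :: "'p \<Rightarrow> real"
    and \<iota> :: "'p \<times> 'q \<Rightarrow> 'm"
    and D1 D2 :: "'p \<times> 'q \<Rightarrow> ('c \<times> 'd) set"
    and D :: "'p \<times> 'q \<Rightarrow> 'c \<times> 'd \<Rightarrow> ('p \<times> 'q \<Rightarrow> 'e) \<Rightarrow> 'e"
    and nablaM :: "'p \<times> 'q \<Rightarrow> 'c \<times> 'd \<Rightarrow> ('p \<times> 'q \<Rightarrow> 'c \<times> 'd) \<Rightarrow> 'c \<times> 'd"
    and X Z :: "'p \<times> 'q \<Rightarrow> 'c \<times> 'd"
    and U :: "('p \<times> 'q) set"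
  defines "M \<equiv> prod_manifold NT NP"
  assumes kenmotsu: "kenmotsu Q \<phi> \<xi> \<eta> g nablaQ"
    and warped: "warped_product_submanifold NT gT NP gP f Q g \<iota>"
    and semi_slant: "semi_slant_submanifold M Q \<iota> \<phi> \<xi> g D1 D2 (pi / 2)"
    and xi_tangent: "\<And>x. \<xi> (\<iota> x) \<in> tangent_map M Q \<iota> x ` factor1_bundle x"
    and NT_bundle: "\<And>x. tangent_map M Q \<iota> x ` factor1_bundle x =
      {tangent_map M Q \<iota> x a + r *\<^sub>R \<xi> (\<iota> x) | a r. a \<in> D1 x}"
    and NP_bundle: "\<And>x. D2 x = factor2_bundle x"
    and invariant: "\<And>q. invariant_submanifold NT Q (\<lambda>p. \<iota> (p, q)) \<phi>"
    and anti_invariant: "\<And>p. anti_invariant_submanifold NP Q (\<lambda>q. \<iota> (p, q)) g \<phi>"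
    and nablaM: "levi_civita M (induced_metric M Q \<iota> g) nablaM"
    and D: "pullback_connection M Q \<iota> nablaQ D"
    and U: "open U"
    and X: "smooth_field M U X" "\<And>x. x \<in> U \<Longrightarrow> X x \<in> factor1_bundle x"
    and Z: "smooth_field M U Z" "\<And>x. x \<in> U \<Longrightarrow> Z x \<in> factor2_bundle x"
  shows "\<forall>x\<in>U. deriv_normal_op M Q \<iota> g \<phi> D nablaM x (X x) Z
           \<in> invariant_normal_subbundle M Q \<iota> g \<phi> factor2_bundle x"
proof
  fix x assume x: "x \<in> U"
  have acm: "almost_contact_metric Q \<phi> \<xi> \<eta> g" and lcQ: "levi_civita Q g nablaQ"
    using kenmotsu by (simp_all add: kenmotsu_def)
  have g: "riemannian_manifold Q g" and phi_linear: "\<forall>p. linear (\<phi> p)"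
    and phi_isometry: "\<forall>p u v. g p u v = g p (\<phi> p u) (\<phi> p v) + \<eta> p u * \<eta> p v"
    and phi_skew: "\<forall>p u v. g p u (\<phi> p v) = - g p (\<phi> p u) v"
    and xi_dual: "\<forall>p v. g p v (\<xi> p) = \<eta> p v" and phi_xi: "\<forall>p. \<phi> p (\<xi> p) = 0"
    using acm unfolding almost_contact_metric_def by - (elim conjE, assumption)+
  note phi = phi_isometry[rule_format] phi_skew[rule_format] xi_dual[rule_format]
    phi_xi[rule_format] phi_linear[rule_format]
  have gT: "riemannian_manifold NT gT" and gP: "riemannian_manifold NP gP"
    and sub: "submanifold M Q \<iota>" and metric: "induced_metric M Q \<iota> g = warped_metric gT gP f"
    using warped by (simp_all add: warped_product_submanifold_def M_def)
  interpret pullback_connection_on_map M Q \<iota> nablaQ D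
    using sub D lcQ by unfold_locales (simp_all add: submanifold_def levi_civita_def)
  note bil = riemannian_manifoldD(2)[OF g] and sym = riemannian_manifoldD(3)[OF g]
  have inj: "inj (tangent_map M Q \<iota> y)" for y
    using sub by (cases y) (simp add: submanifold_def)
  \<comment> \<open>A warped metric has no mixed terms.\<close>
  have orth: "g (\<iota> y) (tangent_map M Q \<iota> y a) (tangent_map M Q \<iota> y z) = 0"
    if "a \<in> factor1_bundle y" "z \<in> factor2_bundle y" for y a z
    using fun_cong[OF fun_cong[OF fun_cong[OF metric, of y], of a], of z] that
    by (auto simp: induced_metric_def warped_metric_def factor1_bundle_def factor2_bundle_def
        bilinear_rzero[OF riemannian_manifoldD(2)[OF gT]]
        bilinear_lzero[OF riemannian_manifoldD(2)[OF gP]])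
  have D1_invariant:
    "\<forall>y. \<phi> (\<iota> y) ` tangent_map M Q \<iota> y ` D1 y = tangent_map M Q \<iota> y ` D1 y"
    using semi_slant unfolding semi_slant_submanifold_def by (elim conjE)
  \<comment> \<open>\<phi> kills the \<xi> component and maps \<open>D1\<close> onto itself.\<close>
  have phi_factor1: "\<phi> (\<iota> y) (tangent_map M Q \<iota> y a) \<in> tangent_map M Q \<iota> y ` factor1_bundle y"
    if "a \<in> factor1_bundle y" for y a
  proof -
    have "tangent_map M Q \<iota> y a \<in> tangent_map M Q \<iota> y ` factor1_bundle y"
      using that by (rule imageI)
    then obtain a' r where a': "a' \<in> D1 y"
      "tangent_map M Q \<iota> y a = tangent_map M Q \<iota> y a' + r *\<^sub>R \<xi> (\<iota> y)"
      unfolding NT_bundle mem_Collect_eq by (elim exE conjE)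
    then have eq: "\<phi> (\<iota> y) (tangent_map M Q \<iota> y a) = \<phi> (\<iota> y) (tangent_map M Q \<iota> y a')"
      by (simp only: linear_add[OF phi(5)] linear_cmul[OF phi(5)] phi(4) scaleR_zero_right add_0_right)
    have "\<phi> (\<iota> y) (tangent_map M Q \<iota> y a) \<in> \<phi> (\<iota> y) ` tangent_map M Q \<iota> y ` D1 y"
      unfolding eq using a'(1) by (intro imageI)
    then obtain b where b: "b \<in> D1 y" "\<phi> (\<iota> y) (tangent_map M Q \<iota> y a) = tangent_map M Q \<iota> y b"
      unfolding D1_invariant[rule_format, of y] by (elim imageE)
    \<comment> \<open>Coefficient 0 of \<xi> exhibits a vector from \<open>D1\<close> as one tangent
      to the first factor.\<close>
    then have "\<phi> (\<iota> y) (tangent_map M Q \<iota> y a) =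
        tangent_map M Q \<iota> y b + 0 *\<^sub>R \<xi> (\<iota> y) \<and> b \<in> D1 y" by simp
    then show ?thesis
      unfolding NT_bundle mem_Collect_eq by (intro exI)
  qed
  have phi_normal: "\<phi> (\<iota> y) (tangent_map M Q \<iota> y z) \<in> normal_space M Q \<iota> g y"
    if z: "z \<in> factor2_bundle y" for y z
  proof -
    obtain p q where y: "y = (p, q)" by (cases y)
    obtain v where v: "z = (0, v)" using z by (auto simp: factor2_bundle_def)
    have slice: "tangent_map NP Q (\<lambda>q. \<iota> (p, q)) q w = tangent_map M Q \<iota> y (0, w)" for w
      unfolding M_def y
      by (rule tangent_map_slice[OF riemannian_manifoldD(1)[OF gT] riemannian_manifoldD(1)[OF gP]
            manifold_map_axioms[unfolded M_def]])
    have factor2: "g (\<iota> y) (\<phi> (\<iota> y) (tangent_map M Q \<iota> y z)) (tangent_map M Q \<iota> y (0, w)) = 0" for w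
    proof -
      have "\<phi> (\<iota> (p, q)) (tangent_map NP Q (\<lambda>q. \<iota> (p, q)) q v) \<in> normal_space NP Q (\<lambda>q. \<iota> (p, q)) g q"
        by (rule subsetD[OF conjunct2[OF anti_invariant[unfolded anti_invariant_submanifold_def],
              THEN spec]]) (intro imageI rangeI)
      then show ?thesis
        by (simp add: normal_space_def slice y[symmetric] v)
    qed
    \<comment> \<open>Skew-symmetry moves \<phi> to the vector of the first factor, where it stays
      tangent to that factor and so orthogonal to \<open>z\<close>.\<close>
    have factor1: "g (\<iota> y) (\<phi> (\<iota> y) (tangent_map M Q \<iota> y z)) (tangent_map M Q \<iota> y (w, 0)) = 0" for w
    proof -
      have w: "(w, 0) \<in> factor1_bundle y" by (simp add: factor1_bundle_def)
      obtain b where "b \<in> factor1_bundle y"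
        "\<phi> (\<iota> y) (tangent_map M Q \<iota> y (w, 0)) = tangent_map M Q \<iota> y b"
        using phi_factor1[OF w] by (elim imageE)
      then have "g (\<iota> y) (\<phi> (\<iota> y) (tangent_map M Q \<iota> y (w, 0))) (tangent_map M Q \<iota> y z) = 0"
        using orth[OF _ z] by simp
      then have "g (\<iota> y) (tangent_map M Q \<iota> y (w, 0)) (\<phi> (\<iota> y) (tangent_map M Q \<iota> y z)) = 0"
        by (simp only: phi(2) neg_equal_0_iff_equal)
      then show ?thesis
        by (simp only: sym[of _ _ "tangent_map M Q \<iota> y (w, 0)"])
    qed
    have split: "tangent_map M Q \<iota> y u =
        tangent_map M Q \<iota> y (fst u, 0) + tangent_map M Q \<iota> y (0, snd u)" for u
      using linear_add[OF linear_tangent_map, of y "(fst u, 0)" "(0, snd u)"] by simp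
    have "g (\<iota> y) (\<phi> (\<iota> y) (tangent_map M Q \<iota> y z)) (tangent_map M Q \<iota> y u) = 0" for u
      by (simp only: split[of u] bilinear_radd[OF bil] factor1 factor2 add_0_left)
    then show ?thesis
      by (simp add: normal_space_def)
  qed
  have normal_op: "normal_op M Q \<iota> g \<phi> y z = \<phi> (\<iota> y) (tangent_map M Q \<iota> y z)"
    if "z \<in> factor2_bundle y" for y z
    unfolding normal_op_def
    by (rule normal_part_unique[OF g phi_normal[OF that]])
      (simp add: range_eqI[of 0 _ 0] linear_0[OF linear_tangent_map])
  obtain t where t: "t \<in> factor1_bundle x" "\<xi> (\<iota> x) = tangent_map M Q \<iota> x t"
    using xi_tangent[of x] by blast
  have eta: "\<eta> (\<iota> x) (tangent_map M Q \<iota> x z) = 0" if "z \<in> factor2_bundle x" for z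
    using orth[OF t(1) that] sym by (simp add: phi(3)[symmetric] t(2))
  let ?T = "tangent_map M Q \<iota> x" and ?h = "g (\<iota> x)" and ?\<phi> = "\<phi> (\<iota> x)"
  define B where "B = D x (X x) (\<lambda>y. normal_op M Q \<iota> g \<phi> y (Z y))"
  define D0 where "D0 = D x (X x) (\<lambda>y. tangent_map M Q \<iota> y (Z y))"
  define n where "n = normal_part M Q \<iota> g x B - normal_part M Q \<iota> g x (?\<phi> (?T (nablaM x (X x) Z)))"
  \<comment> \<open>The \<eta> term of the Kenmotsu equation has dropped out; the \<xi> term
    disappears later, on pairing with a normal vector.\<close>
  have B: "B = ?\<phi> D0 + ?h (?\<phi> (?T (X x))) (?T (Z x)) *\<^sub>R \<xi> (\<iota> x)"
    unfolding B_def D0_def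
    by (subst pullback_kenmotsu[OF kenmotsu U smooth_along_tangent_map[OF U Z(1)] x normal_op[OF Z(2)]])
      (simp_all add: eta Z(2) x)
  have "n \<in> normal_space M Q \<iota> g x"
    using normal_part(1)[OF g inj] by (simp add: n_def normal_space_def bilinear_lsub[OF bil])
  moreover have "?h n (normal_op M Q \<iota> g \<phi> x z) = 0" if z: "z \<in> factor2_bundle x" for z
  proof -
    have "?h (?\<phi> (?T z)) (?T t) = 0"
      using phi_normal[OF z] by (cases t) (simp add: normal_space_def)
    then have xi: "?h (\<xi> (\<iota> x)) (?\<phi> (?T z)) = 0"
      using sym[of "\<iota> x" "?T t" "?\<phi> (?T z)"] by (simp only: t(2))
    \<comment> \<open>Pairing with a normal vector makes both projections disappear, wherever
      \<open>nablaM x (X x) Z\<close> points.\<close>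
    have "?h n (?\<phi> (?T z)) = ?h B (?\<phi> (?T z)) - ?h (?\<phi> (?T (nablaM x (X x) Z))) (?\<phi> (?T z))"
      by (simp add: n_def bilinear_lsub[OF bil] normal_part_inner[OF g inj phi_normal[OF z]])
    \<comment> \<open>\<phi> preserves the metric up to a product of two \<eta> values; one of them
      belongs to \<open>?T z\<close> and is zero, whatever the \<eta> value of the other
      vector.\<close>
    also have "\<dots> = ?h D0 (?T z) - ?h (?T (nablaM x (X x) Z)) (?T z)"
      using phi(1)[of "\<iota> x" D0 "?T z"] phi(1)[of "\<iota> x" "?T (nablaM x (X x) Z)" "?T z"]
      by (simp add: B bilinear_ladd[OF bil] bilinear_lmul[OF bil] xi eta[OF z])
    also have "\<dots> = 0"
      using gauss_formula[OF g lcQ nablaM U Z(1) x] by (simp add: D0_def)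
    finally show ?thesis by (simp add: normal_op[OF z])
  qed
  ultimately have "n \<in> invariant_normal_subbundle M Q \<iota> g \<phi> factor2_bundle x"
    by (simp add: invariant_normal_subbundle_def)
  then show "deriv_normal_op M Q \<iota> g \<phi> D nablaM x (X x) Z
      \<in> invariant_normal_subbundle M Q \<iota> g \<phi> factor2_bundle x"
    by (simp add: deriv_normal_op_def normal_connection_def n_def B_def
        normal_op_def[of M Q \<iota> g \<phi> x "nablaM x (X x) Z"])
qed

end
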